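(* Let $\Omega\subset\mathbb{R}^3$ be a bounded regular domain, $a>0$, $\gamma\in(2,4)$. There holds: i) For each $\lambda\in(0,\lambda^* )$ the sets $\mathcal{N}_\lambda^+$ and $\mathcal{N}_\lambda^-$ are non empty. Moreover, if $\lambda>\lambda^*$ then $\mathcal{N}_\lambda=\emptyset$. ii) For each $\lambda\in(0,\lambda_0^* )$ there exists $u\in H_0^1(\Omega)\setminus\{0\}$ such that $\Phi_\lambda(u)<0$. Moreover, if $\lambda\ge\lambda_0^*$ then $\inf_{t>0}\psi_{\lambda,u}(t)=0$ for each $u\in H_0^1(\Omega)\setminus\{0\}$.
   Context: $\|u\|=(\int_\Omega|\nabla u|^2)^{1/2}$ is the norm on $H_0^1(\Omega)$, $\|u\|_\gamma$ the $L^\gamma(\Omega)$ norm. For $\lambda>0$, $\Phi_\lambda(u)=\frac a2\|u\|^2+\frac\lambda4\|u\|^4-\frac1\gamma\|u\|_\gamma^\gamma$ on $H_0^1(\Omega)$; for $u\ne0$, $\psi_{\lambda,u}(t)=\Phi_\lambda(tu)$, $t\in(0,\infty)$. Nehari sets: $\mathcal{N}_\lambda=\{u\in H_0^1(\Omega)\setminus\{0\}:\psi'_{\lambda,u}(1)=0\}$, $\mathcal{N}_\lambda^+=\{u\in\mathcal{N}_\lambda:\psi''_{\lambda,u}(1)>0\}$, $\mathcal{N}_\lambda^-=\{u\in\mathcal{N}_\lambda:\psi''_{\lambda,u}(1)<0\}$. For $u\ne0$, $\lambda(u)=C_{a,\gamma}\left(\frac{\|u\|_\gamma}{\|u\|}\right)^{\frac{2\gamma}{\gamma-2}}$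 with $C_{a,\gamma}=a\,\frac{\gamma-2}{4-\gamma}\left(\frac{4-\gamma}{2a}\right)^{\frac2{\gamma-2}}$, and $\lambda_0(u)=2\left(\frac2\gamma\right)^{\frac2{\gamma-2}}\lambda(u)$. Set $\lambda^*=\sup_{u\in H_0^1(\Omega)\setminus\{0\}}\lambda(u)$ and $\lambda_0^*=\sup_{u\in H_0^1(\Omega)\setminus\{0\}}\lambda_0(u)$. *)

theory Defs
  imports "HOL-Analysis.Analysis"
begin

definition grad :: "('a::euclidean_space \<Rightarrow> real) \<Rightarrow> 'a \<Rightarrow> 'a" where
  "grad f x = (\<Sum>b\<in>Basis. frechet_derivative f (at x) b *\<^sub>R b)"

text \<open>\<open>C_diff k f\<close>: \<open>f\<close> is of class \<open>C\<^sup>k\<close> on the whole space (in terms of partial derivatives).\<close>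

fun C_diff :: "nat \<Rightarrow> ('a::euclidean_space \<Rightarrow> real) \<Rightarrow> bool" where
  "C_diff 0 f \<longleftrightarrow> continuous_on UNIV f"
| "C_diff (Suc k) f \<longleftrightarrow> (\<forall>x. f differentiable (at x)) \<and>
     (\<forall>b\<in>Basis. C_diff k (\<lambda>x. frechet_derivative f (at x) b))"

definition test_functions :: "'a::euclidean_space set \<Rightarrow> ('a \<Rightarrow> real) set" where
  "test_functions \<Omega> = {\<phi>. (\<forall>k. C_diff k \<phi>) \<and>
     compact (closure {x. \<phi> x \<noteq> 0}) \<and> closure {x. \<phi> x \<noteq> 0} \<subseteq> \<Omega>}"

text \<open>A domain is a nonempty open connected set. It is called regular if its boundary is of class
  \<open>C\<^sup>1\<close>: locally the set lies on one side of the zero level set of a \<open>C\<^sup>1\<close> function with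
  nonvanishing gradient. All \<open>C\<^sup>k\<close> (\<open>k \<ge> 1\<close>) and smooth boundaries are covered.\<close>

definition regular_boundary :: "'a::euclidean_space set \<Rightarrow> bool" where
  "regular_boundary \<Omega> \<longleftrightarrow>
     (\<forall>z\<in>frontier \<Omega>. \<exists>U \<rho>. open U \<and> z \<in> U \<and>
        (\<forall>x\<in>U. \<rho> differentiable (at x)) \<and> continuous_on U (grad \<rho>) \<and>
        (\<forall>x\<in>U. grad \<rho> x \<noteq> 0) \<and>
        \<Omega> \<inter> U = {x\<in>U. \<rho> x < 0} \<and> frontier \<Omega> \<inter> U = {x\<in>U. \<rho> x = 0})"

definition bounded_regular_domain :: "'a::euclidean_space set \<Rightarrow> bool" where
  "bounded_regular_domain \<Omega> \<longleftrightarrow>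
     \<Omega> \<noteq> {} \<and> open \<Omega> \<and> connected \<Omega> \<and> bounded \<Omega> \<and> regular_boundary \<Omega>"

text \<open>Sobolev functions on \<open>\<Omega>\<close> are represented by functions on the whole space whose values
  outside \<open>\<Omega>\<close> are irrelevant; they are not identified when equal almost everywhere, so the
  zero element of a space is the class of all functions vanishing almost everywhere on \<open>\<Omega>\<close>.\<close>

definition L2 :: "'a::euclidean_space set \<Rightarrow> ('a \<Rightarrow> 'b::euclidean_space) set" where
  "L2 \<Omega> = {f. f \<in> borel_measurable (lebesgue_on \<Omega>) \<and>
     integrable (lebesgue_on \<Omega>) (\<lambda>x. (norm (f x))\<^sup>2)}"

definition locally_integrable ::
    "'a::euclidean_space set \<Rightarrow> ('a \<Rightarrow> 'b::euclidean_space) \<Rightarrow> bool" where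
  "locally_integrable \<Omega> f \<longleftrightarrow> (\<forall>K. compact K \<and> K \<subseteq> \<Omega> \<longrightarrow> integrable (lebesgue_on K) f)"

definition has_weak_gradient ::
    "'a::euclidean_space set \<Rightarrow> ('a \<Rightarrow> real) \<Rightarrow> ('a \<Rightarrow> 'a) \<Rightarrow> bool" where
  "has_weak_gradient \<Omega> u g \<longleftrightarrow>
     locally_integrable \<Omega> u \<and> locally_integrable \<Omega> g \<and>
     (\<forall>\<phi>\<in>test_functions \<Omega>.
        (LINT x|lebesgue_on \<Omega>. u x *\<^sub>R grad \<phi> x) = - (LINT x|lebesgue_on \<Omega>. \<phi> x *\<^sub>R g x))"

text \<open>On an open set the weak gradient is unique up to a null set, so the choice does not
  affect the norms below.\<close>

definition weak_grad :: "'a::euclidean_space set \<Rightarrow> ('a \<Rightarrow> real) \<Rightarrow> 'a \<Rightarrow> 'a" where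
  "weak_grad \<Omega> u = (SOME g. has_weak_gradient \<Omega> u g)"

definition H1 :: "'a::euclidean_space set \<Rightarrow> ('a \<Rightarrow> real) set" where
  "H1 \<Omega> = {u. u \<in> L2 \<Omega> \<and> (\<exists>g. has_weak_gradient \<Omega> u g \<and> g \<in> L2 \<Omega>)}"

definition H1_norm :: "'a::euclidean_space set \<Rightarrow> ('a \<Rightarrow> real) \<Rightarrow> real" where
  "H1_norm \<Omega> u = sqrt ((LINT x|lebesgue_on \<Omega>. (u x)\<^sup>2) +
     (LINT x|lebesgue_on \<Omega>. (norm (weak_grad \<Omega> u x))\<^sup>2))"

definition H10 :: "'a::euclidean_space set \<Rightarrow> ('a \<Rightarrow> real) set" where
  "H10 \<Omega> = {u\<in>H1 \<Omega>. \<exists>\<phi>. (\<forall>n. \<phi> n \<in> test_functions \<Omega>) \<and>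
     (\<lambda>n::nat. H1_norm \<Omega> (\<lambda>x. u x - \<phi> n x)) \<longlonglongrightarrow> 0}"

definition H10_nonzero :: "'a::euclidean_space set \<Rightarrow> ('a \<Rightarrow> real) set" where
  "H10_nonzero \<Omega> = {u\<in>H10 \<Omega>. \<not> (AE x in lebesgue_on \<Omega>. u x = 0)}"

definition H10_norm :: "'a::euclidean_space set \<Rightarrow> ('a \<Rightarrow> real) \<Rightarrow> real" where
  "H10_norm \<Omega> u = sqrt (LINT x|lebesgue_on \<Omega>. (norm (weak_grad \<Omega> u x))\<^sup>2)"

text \<open>In dimension 3 and for \<open>2 < \<gamma> < 4\<close> the integral is finite for all \<open>u \<in> H10 \<Omega>\<close> by the
  Sobolev embedding.\<close>

definition L_norm :: "'a::euclidean_space set \<Rightarrow> real \<Rightarrow> ('a \<Rightarrow> real) \<Rightarrow> real" where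
  "L_norm \<Omega> \<gamma> u = (LINT x|lebesgue_on \<Omega>. \<bar>u x\<bar> powr \<gamma>) powr (1 / \<gamma>)"

text \<open>In the following, \<open>l\<close> stands for the parameter usually written lambda.\<close>

definition Phi ::
    "'a::euclidean_space set \<Rightarrow> real \<Rightarrow> real \<Rightarrow> real \<Rightarrow> ('a \<Rightarrow> real) \<Rightarrow> real" where
  "Phi \<Omega> a \<gamma> l u =
     a / 2 * (H10_norm \<Omega> u)\<^sup>2 + l / 4 * H10_norm \<Omega> u ^ 4 - 1 / \<gamma> * L_norm \<Omega> \<gamma> u powr \<gamma>"

definition psi ::
    "'a::euclidean_space set \<Rightarrow> real \<Rightarrow> real \<Rightarrow> real \<Rightarrow> ('a \<Rightarrow> real) \<Rightarrow> real \<Rightarrow> real" where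
  "psi \<Omega> a \<gamma> l u t = Phi \<Omega> a \<gamma> l (\<lambda>x. t * u x)"

definition Nehari ::
    "'a::euclidean_space set \<Rightarrow> real \<Rightarrow> real \<Rightarrow> real \<Rightarrow> ('a \<Rightarrow> real) set" where
  "Nehari \<Omega> a \<gamma> l = {u\<in>H10_nonzero \<Omega>. deriv (psi \<Omega> a \<gamma> l u) 1 = 0}"

definition Nehari_plus ::
    "'a::euclidean_space set \<Rightarrow> real \<Rightarrow> real \<Rightarrow> real \<Rightarrow> ('a \<Rightarrow> real) set" where
  "Nehari_plus \<Omega> a \<gamma> l = {u\<in>Nehari \<Omega> a \<gamma> l. deriv (deriv (psi \<Omega> a \<gamma> l u)) 1 > 0}"

definition Nehari_minus ::
    "'a::euclidean_space set \<Rightarrow> real \<Rightarrow> real \<Rightarrow> real \<Rightarrow> ('a \<Rightarrow> real) set" where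
  "Nehari_minus \<Omega> a \<gamma> l = {u\<in>Nehari \<Omega> a \<gamma> l. deriv (deriv (psi \<Omega> a \<gamma> l u)) 1 < 0}"

definition C_const :: "real \<Rightarrow> real \<Rightarrow> real" where
  "C_const a \<gamma> = a * ((\<gamma> - 2) / (4 - \<gamma>)) * ((4 - \<gamma>) / (2 * a)) powr (2 / (\<gamma> - 2))"

definition lam :: "'a::euclidean_space set \<Rightarrow> real \<Rightarrow> real \<Rightarrow> ('a \<Rightarrow> real) \<Rightarrow> real" where
  "lam \<Omega> a \<gamma> u = C_const a \<gamma> * (L_norm \<Omega> \<gamma> u / H10_norm \<Omega> u) powr (2 * \<gamma> / (\<gamma> - 2))"

definition lam0 :: "'a::euclidean_space set \<Rightarrow> real \<Rightarrow> real \<Rightarrow> ('a \<Rightarrow> real) \<Rightarrow> real" where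
  "lam0 \<Omega> a \<gamma> u = 2 * (2 / \<gamma>) powr (2 / (\<gamma> - 2)) * lam \<Omega> a \<gamma> u"

text \<open>The suprema are taken in the extended reals, so that they are meaningful without a
  prior proof of boundedness.\<close>

definition lam_star :: "'a::euclidean_space set \<Rightarrow> real \<Rightarrow> real \<Rightarrow> ereal" where
  "lam_star \<Omega> a \<gamma> = (SUP u\<in>H10_nonzero \<Omega>. ereal (lam \<Omega> a \<gamma> u))"

definition lam0_star :: "'a::euclidean_space set \<Rightarrow> real \<Rightarrow> real \<Rightarrow> ereal" where
  "lam0_star \<Omega> a \<gamma> = (SUP u\<in>H10_nonzero \<Omega>. ereal (lam0 \<Omega> a \<gamma> u))"

end

theory Submission
  imports Defs "HOL-Real_Asymp.Real_Asymp"
begin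

text \<open>Write \<open>A\<close> for the gradient norm of \<open>u\<close>, \<open>B\<close> for the \<open>\<gamma>\<close>-th power of its \<open>L\<^sup>\<gamma>\<close> norm, and
  \<open>\<beta> = B / A powr \<gamma>\<close>, which is invariant under scaling. The fibering map of \<open>u\<close> depends only on \<open>\<beta>\<close>
  and on the radius \<open>r = t * A\<close>: its derivative vanishes iff \<open>a + l * r\<^sup>2 = \<beta> * r powr (\<gamma> - 2)\<close>.
  At the radius \<open>\<tau>\<close> with \<open>l * \<tau>\<^sup>2 = a * (\<gamma> - 2) / (4 - \<gamma>)\<close> the second derivative of the map changes sign
  on the Nehari set, and the comparison of the two sides at \<open>\<tau>\<close> is the comparison of \<open>l\<close> with
  \<open>lam \<Omega> a \<gamma> u\<close>. Concavity of \<open>r powr (\<gamma> - 2)\<close> as a function of \<open>r\<^sup>2\<close> transfers the inequality at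
  \<open>\<tau>\<close> to all radii, and the intermediate value theorem provides roots on both sides of \<open>\<tau>\<close>. The
  energy itself is treated by replacing \<open>l\<close> with \<open>l / 2\<close> and \<open>\<beta>\<close> with \<open>2 / \<gamma> * \<beta>\<close>.

  Scaling the norm needs uniqueness of weak gradients, and \<open>A > 0\<close> needs a Poincare inequality for
  test functions. The Sobolev embedding plays no role: if \<open>\<bar>u\<bar> powr \<gamma>\<close> were not integrable, then \<open>L_norm\<close>
  would be \<open>0\<close>, and the argument covers \<open>\<beta> = 0\<close>.\<close>

subsection \<open>Smooth functions\<close>

lemma C_diff_SucI:
  assumes "\<And>x. (f has_derivative f' x) (at x)"
    and "\<And>b. b \<in> Basis \<Longrightarrow> C_diff k (\<lambda>x. f' x b)"
  shows "C_diff (Suc k) f"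
proof -
  have "frechet_derivative f (at x) = f' x" for x
    using assms(1) frechet_derivative_at by metis
  then show ?thesis
    using assms by (auto simp: differentiable_def)
qed

lemma C_diff_SucD:
  assumes "C_diff (Suc k) f"
  shows "(f has_derivative frechet_derivative f (at x)) (at x)"
    and "b \<in> Basis \<Longrightarrow> C_diff k (\<lambda>x. frechet_derivative f (at x) b)"
  using assms frechet_derivative_works by auto

text \<open>The recursion does not list continuity of \<open>f\<close> itself at a successor, so it
  is recovered from differentiability. The Leibniz rule needs this, since it pairs a derivative with
  an undifferentiated factor.\<close>

lemma C_diff_Suc_imp: "C_diff (Suc k) f \<Longrightarrow> C_diff k f"
proof (induction k arbitrary: f)
  case 0
  then show ?case
    by (auto intro!: continuous_at_imp_continuous_on differentiable_imp_continuous_within)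
next
  case (Suc k)
  then show ?case by (metis C_diff.simps(2))
qed

lemma C_diff_const: "C_diff k (\<lambda>x. c)"
  by (induction k arbitrary: c) auto

lemma C_diff_add:
  "C_diff k f \<Longrightarrow> C_diff k g \<Longrightarrow> C_diff k (\<lambda>x. f x + g x)"
proof (induction k arbitrary: f g)
  case 0
  then show ?case by (auto intro: continuous_intros)
next
  case (Suc k)
  show ?case
    by (rule C_diff_SucI, rule has_derivative_add)
      (use Suc C_diff_SucD in \<open>auto intro!: Suc.IH simp del: C_diff.simps\<close>)
qed

lemma C_diff_mult:
  "C_diff k f \<Longrightarrow> C_diff k g \<Longrightarrow> C_diff k (\<lambda>x. f x * g x)"
proof (induction k arbitrary: f g)
  case 0
  then show ?case by (auto intro: continuous_intros)
next
  case (Suc k)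
  show ?case
    by (rule C_diff_SucI, rule has_derivative_mult)
      (use Suc C_diff_SucD C_diff_Suc_imp in \<open>auto intro!: C_diff_add Suc.IH simp del: C_diff.simps\<close>)
qed

lemma C_diff_prod:
  "(\<And>i. i \<in> I \<Longrightarrow> C_diff k (f i)) \<Longrightarrow> C_diff k (\<lambda>x. \<Prod>i\<in>I. f i x)"
  by (induction I rule: infinite_finite_induct) (auto intro: C_diff_mult C_diff_const)

text \<open>The functions \<open>flat n\<close> span a space closed under differentiation that contains the standard
  flat function \<open>flat 0\<close>, so that smoothness can be proved for all \<open>n\<close> at once.\<close>

definition flat :: "nat \<Rightarrow> real \<Rightarrow> real" where
  "flat n x = (if x > 0 then exp (- (1 / x)) / x ^ n else 0)"

text \<open>Exponential decay beats every power of \<open>1 / x\<close> as \<open>x\<close>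
  decreases to 0; to the left the function is constantly 0.\<close>

lemma tendsto_flat_0: "(flat n \<longlongrightarrow> 0) (at 0)"
proof -
  have "((\<lambda>x. exp (- (1 / x)) / x ^ n) \<longlongrightarrow> 0) (at_right (0::real))"
    by real_asymp
  then have "(flat n \<longlongrightarrow> 0) (at_right 0)"
    by (rule Lim_transform_eventually) (auto simp: flat_def eventually_at_filter)
  moreover have "(flat n \<longlongrightarrow> 0) (at_left 0)"
    by (rule tendsto_eventually) (auto simp: flat_def eventually_at_filter)
  ultimately show ?thesis
    by (simp add: filterlim_split_at)
qed

lemma has_field_derivative_flat:
  "(flat n has_field_derivative (flat (n + 2) x - real n * flat (n + 1) x)) (at x)"
proof -
  consider "x > 0" | "x = 0" | "x < 0" by linarith
  then show ?thesis
  proof cases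
    case 1
    have "((\<lambda>x. exp (- (1 / x)) / x ^ n) has_field_derivative
        (flat (n + 2) x - real n * flat (n + 1) x)) (at x)"
      using 1 by (cases n) (auto intro!: derivative_eq_intros simp: flat_def field_simps power2_eq_square,
          metis One_nat_def mult.commute neq0_conv power_minus_mult)
    then show ?thesis
      by (rule has_field_derivative_transform_within_open[where S = "{0<..}"])
        (use 1 in \<open>auto simp: flat_def\<close>)
  next
    case 2
    \<comment> \<open>Dividing by \<open>h\<close> raises the exponent by one, so the difference
      quotient of \<open>flat n\<close> at 0 is again a flat function, with known limit 0.\<close>
    have "flat (n + 1) = (\<lambda>h. (flat n h - flat n 0) / h)"
      by (auto simp: flat_def)
    then show ?thesis
      using 2 tendsto_flat_0[of "n + 1"] by (simp add: DERIV_def flat_def)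
  next
    case 3
    have "((\<lambda>x. 0) has_field_derivative (flat (n + 2) x - real n * flat (n + 1) x)) (at x)"
      using 3 by (auto simp: flat_def)
    then show ?thesis
      by (rule has_field_derivative_transform_within_open[where S = "{..<0}"])
        (use 3 in \<open>auto simp: flat_def\<close>)
  qed
qed

text \<open>Affine arguments are enough, as each factor of the bumps below depends on one
  coordinate. \<open>n\<close> stays arbitrary because differentiation leads to \<open>n + 1\<close>
  and \<open>n + 2\<close>.\<close>

lemma C_diff_flat_affine: "C_diff k (\<lambda>x::'a::euclidean_space. flat n (c \<bullet> x + d))"
proof (induction k arbitrary: n)
  case 0
  have "continuous_on UNIV (flat n)"
    by (intro continuous_at_imp_continuous_on ballI DERIV_isCont[OF has_field_derivative_flat])
  then show ?case
    by (auto intro!: continuous_intros continuous_on_compose2[of UNIV "flat n"])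
next
  case (Suc k)
  show ?case
  proof (rule C_diff_SucI)
    fix x :: 'a
    have "((\<lambda>x. c \<bullet> x + d) has_derivative (\<lambda>h. c \<bullet> h)) (at x)"
      by (auto intro!: derivative_eq_intros)
    from has_derivative_compose[OF this has_field_derivative_flat[unfolded has_field_derivative_def]]
    show "((\<lambda>x. flat n (c \<bullet> x + d)) has_derivative
        (\<lambda>h. (flat (n + 2) (c \<bullet> x + d) + (- real n) * flat (n + 1) (c \<bullet> x + d)) * (c \<bullet> h))) (at x)"
      by simp
  next
    fix b :: 'a
    show "C_diff k (\<lambda>x. (flat (n + 2) (c \<bullet> x + d) + (- real n) * flat (n + 1) (c \<bullet> x + d)) * (c \<bullet> b))"
      by (intro C_diff_mult C_diff_add C_diff_const Suc.IH)
  qed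
qed

section \<open>Smooth bump functions on boxes\<close>

definition box_bump :: "real \<Rightarrow> 'a::euclidean_space \<Rightarrow> 'a \<Rightarrow> 'a \<Rightarrow> real" where
  "box_bump m a b x = (\<Prod>i\<in>Basis. flat 0 (m * (x \<bullet> i - a \<bullet> i)) * flat 0 (m * (b \<bullet> i - x \<bullet> i)))"

lemma C_diff_box_bump: "C_diff k (box_bump m a b)"
proof -
  have eq: "box_bump m a b = (\<lambda>x. \<Prod>i\<in>Basis.
      flat 0 ((m *\<^sub>R i) \<bullet> x + (- m * (a \<bullet> i))) * flat 0 ((- m *\<^sub>R i) \<bullet> x + m * (b \<bullet> i)))"
    by (auto simp: box_bump_def fun_eq_iff algebra_simps inner_commute intro!: prod.cong)
  show ?thesis
    unfolding eq by (intro C_diff_prod C_diff_mult C_diff_flat_affine)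
qed

lemma box_bump_bounds: "0 \<le> box_bump m a b x" "box_bump m a b x \<le> 1"
  by (auto simp: box_bump_def flat_def intro!: prod_nonneg prod_le_1 mult_le_one)

lemma box_bump_nonzero_iff:
  assumes "m > 0"
  shows "box_bump m a b x \<noteq> 0 \<longleftrightarrow> x \<in> box a b"
  using assms by (auto simp: box_bump_def flat_def mem_box zero_less_mult_iff split: if_splits)

text \<open>Inside the box every factor is \<open>exp (- (1 / (m * t)))\<close> with
  \<open>t > 0\<close>, which tends to 1 as the steepness \<open>m\<close> grows; outside, some
  factor is 0 for every \<open>m\<close>. \<open>Suc n\<close> keeps the steepness positive.\<close>

lemma box_bump_tendsto:
  "(\<lambda>n. box_bump (real (Suc n)) a b x) \<longlonglongrightarrow> indicator (box a b) x"
proof (cases "x \<in> box a b")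
  case True
  have *: "(\<lambda>n. flat 0 (real (Suc n) * t)) \<longlonglongrightarrow> 1" if "t > 0" for t
  proof -
    have "(\<lambda>n. exp (- (1 / (real (Suc n) * t)))) \<longlonglongrightarrow> 1"
      using that by real_asymp
    then show ?thesis
      using that by (simp add: flat_def zero_less_mult_iff)
  qed
  have "(\<lambda>n. \<Prod>i\<in>Basis. flat 0 (real (Suc n) * (x \<bullet> i - a \<bullet> i)) * flat 0 (real (Suc n) * (b \<bullet> i - x \<bullet> i)))
      \<longlonglongrightarrow> (\<Prod>i\<in>(Basis :: 'a set). 1 * 1)"
    using True by (intro tendsto_prod tendsto_mult *) (auto simp: mem_box)
  then show ?thesis
    using True by (simp add: box_bump_def)
next
  case False
  then show ?thesis
    using box_bump_nonzero_iff[of "real (Suc _)" a b x] by simp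
qed

text \<open>The support is the closure of the open box, which is why the closed box has to fit into
  \<open>\<Omega>\<close>.\<close>

lemma box_bump_test_function:
  assumes "cbox a b \<subseteq> \<Omega>" "m > 0"
  shows "box_bump m a b \<in> test_functions \<Omega>"
proof -
  have "{x. box_bump m a b x \<noteq> 0} = box a b"
    using box_bump_nonzero_iff[OF assms(2)] by blast
  moreover have "closure (box a b) \<subseteq> cbox a b"
    by (intro closure_minimal box_subset_cbox closed_cbox)
  moreover have "compact (closure (box a b))"
    by (simp add: bounded_box)
  ultimately show ?thesis
    using C_diff_box_bump assms(1) by (auto simp: test_functions_def)
qed

lemma test_functionsD:
  assumes "\<phi> \<in> test_functions \<Omega>"
  obtains K where "compact K" "K \<subseteq> \<Omega>" "\<And>x. x \<notin> K \<Longrightarrow> \<phi> x = 0"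
  using assms closure_subset[of "{x. \<phi> x \<noteq> 0}"] unfolding test_functions_def by blast

text \<open>A smooth factor can only shrink the support. This allows localisation: a bump times a
  test function is again admissible.\<close>

lemma test_functions_mult:
  assumes "\<phi> \<in> test_functions \<Omega>" "\<And>k. C_diff k \<psi>"
  shows "(\<lambda>x. \<psi> x * \<phi> x) \<in> test_functions \<Omega>"
proof -
  have "closure {x. \<psi> x * \<phi> x \<noteq> 0} \<subseteq> closure {x. \<phi> x \<noteq> 0}"
    by (rule closure_mono) auto
  then show ?thesis
    using assms closed_subset[OF _ closed_closure] compact_Int_closed
    by (auto simp: test_functions_def intro: C_diff_mult compact_closure bounded_subset
        dest: compact_imp_bounded)
qed

lemma continuous_test_function:
  assumes "\<phi> \<in> test_functions \<Omega>"
  shows "continuous_on UNIV \<phi>"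
proof -
  have "C_diff 0 \<phi>"
    using assms unfolding test_functions_def by blast
  then show ?thesis by simp
qed

subsection \<open>The fundamental lemma of the calculus of variations\<close>

lemma borel_measurable_lebesgue_onI:
  "f \<in> borel_measurable borel \<Longrightarrow> f \<in> borel_measurable (lebesgue_on S)"
  by (simp add: measurable_completion measurable_restrict_space1)

lemma sigma_finite_lebesgue_on:
  assumes "\<Omega> \<in> sets lebesgue"
  shows "sigma_finite_measure (lebesgue_on \<Omega> :: 'a::euclidean_space measure)"
proof -
  have "sigma_finite_measure (lebesgue :: 'a measure)"
  proof
    have "(\<Union>n. cball (0::'a) (real n)) = UNIV"
      by (auto simp: real_arch_simple)
    then show "\<exists>A. countable A \<and> A \<subseteq> sets (lebesgue :: 'a measure) \<and> \<Union>A = space lebesgue \<and>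
        (\<forall>a\<in>A. emeasure lebesgue a \<noteq> \<infinity>)"
      using emeasure_lborel_cball_finite
      by (intro exI[of _ "range (\<lambda>n. cball 0 (real n))"]) (auto simp: less_top)
  qed
  then show ?thesis
    using assms by (rule sigma_finite_measure_restrict_space)
qed

text \<open>Orthogonality passes from bumps to box indicators in the limit, then to Borel sets by a
  Dynkin argument and to Lebesgue sets up to null sets. An integrable function with zero integral
  over every measurable set vanishes almost everywhere.\<close>

lemma AE_zero_if_orthogonal_box_bump:
  fixes F :: "'a::euclidean_space \<Rightarrow> 'b::euclidean_space"
  assumes \<Omega>: "\<Omega> \<in> sets lebesgue" and F: "integrable (lebesgue_on \<Omega>) F"
    and orth: "\<And>m a b. m > 0 \<Longrightarrow> (LINT x|lebesgue_on \<Omega>. box_bump m a b x *\<^sub>R F x) = 0"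
    and total: "(LINT x|lebesgue_on \<Omega>. F x) = 0"
  shows "AE x in lebesgue_on \<Omega>. F x = 0"
proof -
  let ?M = "lebesgue_on \<Omega>"
  interpret sigma_finite_measure ?M
    using \<Omega> by (rule sigma_finite_lebesgue_on)
  have [measurable]: "indicator S \<in> borel_measurable ?M" if "S \<in> sets borel" for S :: "'a set"
    using that by (intro borel_measurable_lebesgue_onI) auto
  have Fm[measurable]: "F \<in> borel_measurable ?M"
    using F by auto
  have int: "integrable ?M (\<lambda>x. indicat_real S x *\<^sub>R F x)" if "S \<in> sets borel" for S
  proof (rule Bochner_Integration.integrable_bound[OF F])
    show "(\<lambda>x. indicat_real S x *\<^sub>R F x) \<in> borel_measurable ?M"
      using that by measurable
  qed (auto simp: indicator_def)
  have borel: "(LINT x|?M. indicat_real S x *\<^sub>R F x) = 0" if S: "S \<in> sets borel" for S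
  proof -
    have eq: "sets borel = sigma_sets UNIV (range (\<lambda>(a, b). box a b::'a set))"
      by (simp add: borel_eq_box)
    \<comment> \<open>Boxes are closed under intersection and generate the Borel sets, so the
      induction has only boxes, complements and disjoint unions to treat.\<close>
    have "Int_stable (range (\<lambda>(a, b). box a b::'a set))"
      by (auto simp: Int_stable_def box_Int_box)
    moreover have "range (\<lambda>(a, b). box a b::'a set) \<subseteq> Pow UNIV" by auto
    moreover have "S \<in> sigma_sets UNIV (range (\<lambda>(a, b). box a b::'a set))"
      using S eq by auto
    ultimately show ?thesis
    proof (induct rule: sigma_sets_induct_disjoint)
      case (basic A)
      then obtain a b where A: "A = box a b" by auto
      have "(\<lambda>n. LINT x|?M. box_bump (real (Suc n)) a b x *\<^sub>R F x)
          \<longlonglongrightarrow> (LINT x|?M. indicat_real (box a b) x *\<^sub>R F x)"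
      proof (rule integral_dominated_convergence)
        show "(\<lambda>x. indicat_real (box a b) x *\<^sub>R F x) \<in> borel_measurable ?M"
          using int[of "box a b"] by auto
        have "box_bump m a b \<in> borel_measurable ?M" for m
          using C_diff_box_bump[of 0 m a b]
          by (auto intro!: borel_measurable_lebesgue_onI borel_measurable_continuous_onI)
        then show "(\<lambda>x. box_bump (real (Suc n)) a b x *\<^sub>R F x) \<in> borel_measurable ?M" for n
          by measurable
        show "integrable ?M (\<lambda>x. norm (F x))" using F by simp
        show "AE x in ?M. (\<lambda>n. box_bump (real (Suc n)) a b x *\<^sub>R F x)
            \<longlonglongrightarrow> indicat_real (box a b) x *\<^sub>R F x"
          by (intro AE_I2 tendsto_scaleR box_bump_tendsto tendsto_const)
        show "AE x in ?M. norm (box_bump (real (Suc n)) a b x *\<^sub>R F x) \<le> norm (F x)" for n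
          by (auto intro!: AE_I2 mult_left_le_one_le simp: abs_of_nonneg box_bump_bounds)
      qed
      then show ?case
        using orth[of "real (Suc _)"] by (simp add: A LIMSEQ_const_iff)
    next
      case empty
      then show ?case by simp
    next
      case (compl A)
      then have A: "A \<in> sets borel" using eq by simp
      have "indicat_real (UNIV - A) x *\<^sub>R F x = F x - indicat_real A x *\<^sub>R F x" for x
        by (simp add: indicator_def)
      \<comment> \<open>Complements require the integral of \<open>F\<close> itself to vanish; this
        is the role of \<open>total\<close>.\<close>
      then show ?case
        using F int[OF A] compl total by simp
    next
      case (union A)
      have A: "A i \<in> sets borel" for i
        using union eq by auto
      \<comment> \<open>Intersecting with \<open>\<Omega>\<close> makes the sets measurable in
        \<open>?M\<close> and does not change the integrals.\<close>
      have "set_lebesgue_integral ?M (\<Union>i. A i \<inter> \<Omega>) F = (\<Sum>i. set_lebesgue_integral ?M (A i \<inter> \<Omega>) F)"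
      proof (rule lebesgue_integral_countable_add)
        show "A i \<inter> \<Omega> \<in> sets ?M" for i
          using A[of i] by (auto simp: sets_restrict_space)
        show "i \<noteq> j \<Longrightarrow> A i \<inter> \<Omega> \<inter> (A j \<inter> \<Omega>) = {}" for i j
          using union by (auto simp: disjoint_family_on_def)
        show "set_integrable ?M (\<Union>i. A i \<inter> \<Omega>) F"
          unfolding set_integrable_def
          using int[of "\<Union>i. A i"] A
          by (rule_tac Bochner_Integration.integrable_cong[THEN iffD1, rotated 2]) (auto simp: indicator_def)
      qed
      moreover have "set_lebesgue_integral ?M (A i \<inter> \<Omega>) F = 0" for i
        using union(3)[of i] unfolding set_lebesgue_integral_def
        by (rule trans[rotated]) (auto intro!: Bochner_Integration.integral_cong simp: indicator_def)
      moreover have "set_lebesgue_integral ?M (\<Union>i. A i \<inter> \<Omega>) F = (LINT x|?M. indicat_real (\<Union>i. A i) x *\<^sub>R F x)"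
        unfolding set_lebesgue_integral_def
        by (auto intro!: Bochner_Integration.integral_cong simp: indicator_def)
      ultimately show ?case by simp
    qed
  qed
  show ?thesis
  proof (rule density_zero[OF F])
    fix A assume "A \<in> sets ?M"
    then have "A \<in> sets lebesgue"
      using \<Omega> by (auto simp: sets_restrict_space_iff)
    \<comment> \<open>A Lebesgue set is a Borel set up to a null set, so the Borel case carries
      over.\<close>
    then obtain S N N' where A: "A = S \<union> N" "N \<subseteq> N'" "N' \<in> null_sets lborel" "S \<in> sets lborel"
      by (elim sets_completionE) auto
    have "N' \<in> null_sets lebesgue"
      using A by (simp add: null_sets_completionI)
    then have "AE x in lebesgue. x \<notin> N'"
      by (rule AE_not_in)
    then have "AE x in ?M. x \<notin> N'"
      using \<Omega> by (auto simp: AE_restrict_space_iff elim: eventually_mono)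
    then have AE: "AE x in ?M. indicat_real A x *\<^sub>R F x = indicat_real S x *\<^sub>R F x"
      by eventually_elim (use A in \<open>auto simp: indicator_def\<close>)
    have "(\<lambda>x. indicat_real A x *\<^sub>R F x) \<in> borel_measurable ?M"
      using \<open>A \<in> sets ?M\<close> by measurable
    moreover have "(\<lambda>x. indicat_real S x *\<^sub>R F x) \<in> borel_measurable ?M"
      using int[of S] A by auto
    ultimately have "set_lebesgue_integral ?M A F = (LINT x|?M. indicat_real S x *\<^sub>R F x)"
      unfolding set_lebesgue_integral_def using AE by (rule integral_cong_AE)
    then show "set_lebesgue_integral ?M A F = 0"
      using borel[of S] A by simp
  qed
qed

lemma integrable_lebesgue_on_superset:
  fixes f :: "'a::euclidean_space \<Rightarrow> 'b::euclidean_space"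
  assumes "integrable (lebesgue_on K) f" "K \<subseteq> \<Omega>" "K \<in> sets lebesgue" "\<Omega> \<in> sets lebesgue"
    and "\<And>x. x \<in> \<Omega> \<Longrightarrow> x \<notin> K \<Longrightarrow> f x = 0"
  shows "integrable (lebesgue_on \<Omega>) f"
proof -
  have "(\<lambda>x. indicat_real K x *\<^sub>R f x) = (\<lambda>x. indicat_real \<Omega> x *\<^sub>R f x)"
    using assms by (auto simp: fun_eq_iff indicator_def)
  then show ?thesis
    using assms by (simp add: integrable_restrict_space)
qed

text \<open>\<open>\<psi>\<close> is bounded on \<open>K\<close> and vanishes off it, so the product
  is dominated on \<open>K\<close> by a multiple of \<open>u\<close> and extends by zero. This
  supplies the integrability behind the linearity of integrals against test functions.\<close>

lemma integrable_locally_integrable_mult: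
  fixes u :: "'a::euclidean_space \<Rightarrow> 'b::euclidean_space" and \<psi> :: "'a \<Rightarrow> real"
  assumes u: "locally_integrable \<Omega> u" and \<Omega>: "\<Omega> \<in> sets lebesgue"
    and \<psi>: "continuous_on UNIV \<psi>" "compact K" "K \<subseteq> \<Omega>" "\<And>x. x \<notin> K \<Longrightarrow> \<psi> x = 0"
  shows "integrable (lebesgue_on \<Omega>) (\<lambda>x. \<psi> x *\<^sub>R u x)"
proof (rule integrable_lebesgue_on_superset[of K])
  have u: "integrable (lebesgue_on K) u"
    using u \<psi> by (auto simp: locally_integrable_def)
  have "bounded (\<psi> ` K)"
    using \<psi> by (meson compact_continuous_image compact_imp_bounded continuous_on_subset subset_UNIV)
  then obtain B where B: "\<And>x. x \<in> K \<Longrightarrow> norm (\<psi> x) \<le> B"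
    by (auto simp: bounded_iff)
  show "integrable (lebesgue_on K) (\<lambda>x. \<psi> x *\<^sub>R u x)"
  proof (rule Bochner_Integration.integrable_bound)
    show "integrable (lebesgue_on K) (\<lambda>x. B *\<^sub>R u x)"
      using u by simp
    have "\<psi> \<in> borel_measurable (lebesgue_on K)"
      using \<psi> by (intro borel_measurable_lebesgue_onI borel_measurable_continuous_onI)
    then show "(\<lambda>x. \<psi> x *\<^sub>R u x) \<in> borel_measurable (lebesgue_on K)"
      using u by measurable
    show "AE x in lebesgue_on K. norm (\<psi> x *\<^sub>R u x) \<le> norm (B *\<^sub>R u x)"
      using B by (force intro!: AE_I2 mult_right_mono)
  qed
qed (use assms in \<open>auto intro: lmeasurable_compact fmeasurableD\<close>)

lemma locally_integrable_continuous:
  fixes u :: "'a::euclidean_space \<Rightarrow> 'b::euclidean_space"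
  assumes "continuous_on UNIV u"
  shows "locally_integrable \<Omega> u"
  unfolding locally_integrable_def
proof (intro allI impI)
  fix K assume "compact K \<and> K \<subseteq> \<Omega>"
  then have K: "compact K" by simp
  have "integrable lborel (\<lambda>x. indicat_real K x *\<^sub>R u x)"
    using K assms by (intro borel_integrable_compact continuous_on_subset[OF assms]) auto
  then have "integrable lebesgue (\<lambda>x. indicat_real K x *\<^sub>R u x)"
    by (subst integrable_completion) auto
  then show "integrable (lebesgue_on K) u"
    using K by (simp add: integrable_restrict_space lmeasurable_compact fmeasurableD)
qed

lemma locally_integrable_diff:
  "locally_integrable \<Omega> f \<Longrightarrow> locally_integrable \<Omega> g \<Longrightarrow> locally_integrable \<Omega> (\<lambda>x. f x - g x)"
  by (auto simp: locally_integrable_def)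

lemma integrable_continuous_compact_support:
  fixes \<psi> :: "'a::euclidean_space \<Rightarrow> real"
  assumes "\<Omega> \<in> sets lebesgue"
    "continuous_on UNIV \<psi>" "compact K" "K \<subseteq> \<Omega>" "\<And>x. x \<notin> K \<Longrightarrow> \<psi> x = 0"
  shows "integrable (lebesgue_on \<Omega>) \<psi>"
  using integrable_locally_integrable_mult[OF locally_integrable_continuous assms, of "\<lambda>_. 1 :: real"]
  by simp

text \<open>As \<open>w\<close> is only locally integrable, it is first multiplied by a test
  function: the product is integrable and orthogonal to all box bumps, hence zero almost everywhere.
  Choosing a bump as that test function gives \<open>w x = 0\<close> on each box whose closure lies
  in \<open>\<Omega>\<close>.\<close>

lemma AE_zero_if_orthogonal_test_functions:
  fixes w :: "'a::euclidean_space \<Rightarrow> 'b::euclidean_space"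
  assumes \<Omega>: "open \<Omega>" and w: "locally_integrable \<Omega> w"
    and orth: "\<And>\<phi>. \<phi> \<in> test_functions \<Omega> \<Longrightarrow> (LINT x|lebesgue_on \<Omega>. \<phi> x *\<^sub>R w x) = 0"
  shows "AE x in lebesgue_on \<Omega>. w x = 0"
proof -
  have \<Omega>': "\<Omega> \<in> sets lebesgue"
    using \<Omega> by simp
  have AE: "AE x in lebesgue_on \<Omega>. \<phi> x *\<^sub>R w x = 0" if \<phi>: "\<phi> \<in> test_functions \<Omega>" for \<phi>
  proof (rule AE_zero_if_orthogonal_box_bump[OF \<Omega>'])
    from \<phi> obtain K where "compact K" "K \<subseteq> \<Omega>" "\<And>x. x \<notin> K \<Longrightarrow> \<phi> x = 0"
      using test_functionsD by blast
    then show "integrable (lebesgue_on \<Omega>) (\<lambda>x. \<phi> x *\<^sub>R w x)"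
      using integrable_locally_integrable_mult[OF w \<Omega>' continuous_test_function[OF \<phi>]] by blast
    show "(LINT x|lebesgue_on \<Omega>. box_bump m a b x *\<^sub>R \<phi> x *\<^sub>R w x) = 0" for m a b
      using orth[OF test_functions_mult[OF \<phi> C_diff_box_bump]] by simp
  qed (use orth[OF \<phi>] in auto)
  define \<F> where "\<F> = {box a b |a b. cbox a b \<subseteq> \<Omega>}"
  have \<F>: "\<Union>\<F> = \<Omega>"
  proof
    show "\<Union>\<F> \<subseteq> \<Omega>"
      using box_subset_cbox by (fastforce simp: \<F>_def)
    show "\<Omega> \<subseteq> \<Union>\<F>"
    proof
      fix x assume "x \<in> \<Omega>"
      with \<Omega> obtain e where e: "e > 0" "cball x e \<subseteq> \<Omega>"
        using open_contains_cball by blast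
      then obtain a b where "x \<in> box a b" "cbox a b \<subseteq> cball x e"
      proof -
        obtain a b where "x \<in> box a b" "box a b \<subseteq> ball x e"
          using rational_boxes[OF e(1)] by metis
        \<comment> \<open>The box contains \<open>x\<close>, so it is nonempty and its closure is
          the closed box; closures preserve the inclusion.\<close>
        moreover have "cbox a b \<subseteq> cball x e"
          using calculation closure_mono[of "box a b" "ball x e"] e
          by (metis closure_ball closure_box empty_iff)
        ultimately show ?thesis using that by blast
      qed
      then show "x \<in> \<Union>\<F>" using e unfolding \<F>_def by blast
    qed
  qed
  \<comment> \<open>Countably many boxes cover \<open>\<Omega>\<close>, so the exceptional null sets
    can be united.\<close>
  obtain \<G> where \<G>: "\<G> \<subseteq> \<F>" "countable \<G>" "\<Union>\<G> = \<Union>\<F>"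
    by (rule Lindelof[of \<F>]) (auto simp: \<F>_def open_box)
  have "AE x in lebesgue_on \<Omega>. x \<in> B \<longrightarrow> w x = 0" if "B \<in> \<F>" for B
  proof -
    from that obtain a b where B: "B = box a b" "cbox a b \<subseteq> \<Omega>"
      by (auto simp: \<F>_def)
    from AE[OF box_bump_test_function[OF B(2), of 1]] show ?thesis
      by (rule AE_mp) (use B box_bump_nonzero_iff[of 1 a b] in \<open>auto intro!: AE_I2\<close>)
  qed
  then have "AE x in lebesgue_on \<Omega>. \<forall>B\<in>\<G>. x \<in> B \<longrightarrow> w x = 0"
    using \<G> by (subst AE_ball_countable) auto
  then show ?thesis
    by (rule lebesgue_on_mono) (use \<G>(3) \<F> in blast)
qed

subsection \<open>Weak gradients\<close>

text \<open>Both candidates have the same integral against every test function, so the fundamental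
  lemma applies to their difference. This makes the arbitrary choice in \<open>weak_grad\<close>
  harmless.\<close>

lemma has_weak_gradient_unique:
  assumes \<Omega>: "open \<Omega>" and g: "has_weak_gradient \<Omega> u g" and h: "has_weak_gradient \<Omega> u h"
  shows "AE x in lebesgue_on \<Omega>. g x = h x"
proof -
  have \<Omega>': "\<Omega> \<in> sets lebesgue"
    using \<Omega> by simp
  have "AE x in lebesgue_on \<Omega>. g x - h x = 0"
  proof (rule AE_zero_if_orthogonal_test_functions[OF \<Omega>])
    show "locally_integrable \<Omega> (\<lambda>x. g x - h x)"
      using g h by (auto simp: has_weak_gradient_def intro: locally_integrable_diff)
    fix \<phi> assume \<phi>: "\<phi> \<in> test_functions \<Omega>"
    then obtain K where K: "compact K" "K \<subseteq> \<Omega>" "\<And>x. x \<notin> K \<Longrightarrow> \<phi> x = 0"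
      using test_functionsD by blast
    have "integrable (lebesgue_on \<Omega>) (\<lambda>x. \<phi> x *\<^sub>R g x)" "integrable (lebesgue_on \<Omega>) (\<lambda>x. \<phi> x *\<^sub>R h x)"
      using g h integrable_locally_integrable_mult[OF _ \<Omega>' continuous_test_function[OF \<phi>] K]
      by (auto simp: has_weak_gradient_def)
    moreover have "(LINT x|lebesgue_on \<Omega>. \<phi> x *\<^sub>R g x) = (LINT x|lebesgue_on \<Omega>. \<phi> x *\<^sub>R h x)"
      using g h \<phi> by (auto simp: has_weak_gradient_def)
    ultimately show "(LINT x|lebesgue_on \<Omega>. \<phi> x *\<^sub>R (g x - h x)) = 0"
      by (simp add: scaleR_diff_right)
  qed
  then show ?thesis by simp
qed

lemma weak_grad_AE_eq:
  assumes "open \<Omega>" "has_weak_gradient \<Omega> u g"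
  shows "AE x in lebesgue_on \<Omega>. weak_grad \<Omega> u x = g x"
  using assms has_weak_gradient_unique someI[of "has_weak_gradient \<Omega> u"]
  unfolding weak_grad_def by blast

lemma has_weak_gradient_weak_grad:
  "has_weak_gradient \<Omega> u g \<Longrightarrow> has_weak_gradient \<Omega> u (weak_grad \<Omega> u)"
  unfolding weak_grad_def by (metis someI)

lemma has_weak_gradient_scale:
  assumes "has_weak_gradient \<Omega> u g"
  shows "has_weak_gradient \<Omega> (\<lambda>x. t * u x) (\<lambda>x. t *\<^sub>R g x)"
proof -
  have "(LINT x|lebesgue_on \<Omega>. (t * u x) *\<^sub>R grad \<phi> x) = - (LINT x|lebesgue_on \<Omega>. \<phi> x *\<^sub>R t *\<^sub>R g x)"
    if "\<phi> \<in> test_functions \<Omega>" for \<phi>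
  proof -
    have "(LINT x|lebesgue_on \<Omega>. (t * u x) *\<^sub>R grad \<phi> x) = t *\<^sub>R (LINT x|lebesgue_on \<Omega>. u x *\<^sub>R grad \<phi> x)"
      by (simp flip: scaleR_scaleR)
    also have "\<dots> = - (t *\<^sub>R (LINT x|lebesgue_on \<Omega>. \<phi> x *\<^sub>R g x))"
      using assms that by (auto simp: has_weak_gradient_def)
    also have "t *\<^sub>R (LINT x|lebesgue_on \<Omega>. \<phi> x *\<^sub>R g x) = (LINT x|lebesgue_on \<Omega>. \<phi> x *\<^sub>R t *\<^sub>R g x)"
      by (simp add: mult.commute flip: integral_scaleR_right)
    finally show ?thesis .
  qed
  then show ?thesis
    using assms by (auto simp: has_weak_gradient_def locally_integrable_def)
qed

lemma frechet_derivative_eq_0_outside: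
  fixes f :: "'a::euclidean_space \<Rightarrow> real"
  assumes "closed K" "\<And>x. x \<notin> K \<Longrightarrow> f x = 0" "x \<notin> K"
  shows "frechet_derivative f (at x) b = 0"
proof -
  have "((\<lambda>_. 0 :: real) has_derivative (\<lambda>_. 0)) (at x)"
    by simp
  then have "(f has_derivative (\<lambda>_. 0)) (at x)"
    by (rule has_derivative_transform_within_open[OF _ open_Compl[OF assms(1)]]) (use assms in auto)
  then show ?thesis
    using frechet_derivative_at by metis
qed

lemma test_function_derivative:
  assumes "\<phi> \<in> test_functions \<Omega>"
  shows "(\<phi> has_derivative frechet_derivative \<phi> (at x)) (at x)"
    and "b \<in> Basis \<Longrightarrow> continuous_on UNIV (\<lambda>x. frechet_derivative \<phi> (at x) b)"
proof -
  have "C_diff (Suc 0) \<phi>"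
    using assms unfolding test_functions_def by blast
  then show "(\<phi> has_derivative frechet_derivative \<phi> (at x)) (at x)"
    and "b \<in> Basis \<Longrightarrow> continuous_on UNIV (\<lambda>x. frechet_derivative \<phi> (at x) b)"
    using C_diff_SucD(1)[of 0 \<phi>] by auto
qed

text \<open>In coordinates, the gradient has continuous components supported in a compact subset of
  \<open>\<Omega>\<close>, and each may be multiplied with a locally integrable function.\<close>

lemma integrable_mult_grad:
  assumes \<Omega>: "\<Omega> \<in> sets lebesgue" and u: "locally_integrable \<Omega> u" and \<phi>: "\<phi> \<in> test_functions \<Omega>"
  shows "integrable (lebesgue_on \<Omega>) (\<lambda>x. u x *\<^sub>R grad \<phi> x)"
proof -
  from \<phi> obtain K where K: "compact K" "K \<subseteq> \<Omega>" "\<And>x. x \<notin> K \<Longrightarrow> \<phi> x = 0"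
    using test_functionsD by blast
  have z: "frechet_derivative \<phi> (at x) b = 0" if "x \<notin> K" for x b
    by (rule frechet_derivative_eq_0_outside[where K = K]) (use K that in \<open>auto intro: compact_imp_closed\<close>)
  have "integrable (lebesgue_on \<Omega>) (\<lambda>x. (frechet_derivative \<phi> (at x) b *\<^sub>R u x) *\<^sub>R b)"
    if b: "b \<in> Basis" for b
  proof -
    have "integrable (lebesgue_on \<Omega>) (\<lambda>x. frechet_derivative \<phi> (at x) b *\<^sub>R u x)"
      using integrable_locally_integrable_mult[OF u \<Omega> test_function_derivative(2)[OF \<phi> b] K(1,2) z] .
    then show ?thesis by simp
  qed
  then have "integrable (lebesgue_on \<Omega>)
      (\<lambda>x. \<Sum>b\<in>Basis. (frechet_derivative \<phi> (at x) b *\<^sub>R u x) *\<^sub>R b)"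
    by (rule Bochner_Integration.integrable_sum)
  moreover have "u x *\<^sub>R grad \<phi> x = (\<Sum>b\<in>Basis. (frechet_derivative \<phi> (at x) b *\<^sub>R u x) *\<^sub>R b)" for x
    by (simp add: grad_def scaleR_sum_right mult.commute)
  ultimately show ?thesis by simp
qed

lemma has_weak_gradient_diff:
  assumes \<Omega>: "\<Omega> \<in> sets lebesgue"
    and u: "has_weak_gradient \<Omega> u g" and v: "has_weak_gradient \<Omega> v h"
  shows "has_weak_gradient \<Omega> (\<lambda>x. u x - v x) (\<lambda>x. g x - h x)"
proof -
  have "(LINT x|lebesgue_on \<Omega>. (u x - v x) *\<^sub>R grad \<phi> x)
      = - (LINT x|lebesgue_on \<Omega>. \<phi> x *\<^sub>R (g x - h x))" if \<phi>: "\<phi> \<in> test_functions \<Omega>" for \<phi>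
  proof -
    from \<phi> obtain K where K: "compact K" "K \<subseteq> \<Omega>" "\<And>x. x \<notin> K \<Longrightarrow> \<phi> x = 0"
      using test_functionsD by blast
    have "integrable (lebesgue_on \<Omega>) (\<lambda>x. \<phi> x *\<^sub>R g x)" "integrable (lebesgue_on \<Omega>) (\<lambda>x. \<phi> x *\<^sub>R h x)"
      using u v integrable_locally_integrable_mult[OF _ \<Omega> continuous_test_function[OF \<phi>] K]
      by (auto simp: has_weak_gradient_def)
    moreover have "integrable (lebesgue_on \<Omega>) (\<lambda>x. u x *\<^sub>R grad \<phi> x)"
      "integrable (lebesgue_on \<Omega>) (\<lambda>x. v x *\<^sub>R grad \<phi> x)"
      using u v integrable_mult_grad[OF \<Omega> _ \<phi>] by (auto simp: has_weak_gradient_def)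
    ultimately show ?thesis
      using u v \<phi> by (auto simp: has_weak_gradient_def scaleR_diff_left scaleR_diff_right)
  qed
  then show ?thesis
    using u v by (auto simp: has_weak_gradient_def intro: locally_integrable_diff)
qed

section \<open>Integration by parts for compactly supported functions\<close>

lemma integral_lborel_translate:
  fixes f :: "'a::euclidean_space \<Rightarrow> real"
  assumes "integrable lborel f"
  shows "integrable lborel (\<lambda>x. f (x + c))" "(LINT x|lborel. f (x + c)) = (LINT x|lborel. f x)"
proof -
  have f: "f \<in> borel_measurable borel"
    using borel_measurable_integrable[OF assms] by simp
  have "(\<lambda>x. x + c) = (+) c"
    by (auto simp: add.commute)
  then have eq: "distr lborel borel (\<lambda>x. x + c) = lborel"
    using lborel_distr_plus[of c] by simp
  have m: "(\<lambda>x. x + c) \<in> measurable lborel borel"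
    by simp
  show "integrable lborel (\<lambda>x. f (x + c))"
    using assms integrable_distr_eq[OF m f] unfolding eq by blast
  show "(LINT x|lborel. f (x + c)) = (LINT x|lborel. f x)"
    using integral_distr[OF m f] unfolding eq by simp
qed

text \<open>The difference quotients in direction \<open>b\<close> have integral zero by translation invariance, and
  they converge boundedly, with supports in a fixed ball.\<close>

lemma integral_partial_derivative_eq_0:
  fixes f :: "'a::euclidean_space \<Rightarrow> real"
  assumes f: "\<And>x. (f has_derivative f' x) (at x)" and f': "continuous_on UNIV (\<lambda>x. f' x b)"
    and K: "compact K" "\<And>x. x \<notin> K \<Longrightarrow> f x = 0"
  shows "(LINT x|lborel. f' x b) = 0"
proof -
  define h where "h n = 1 / real (Suc n)" for n
  have h: "h n > 0" "h n \<le> 1" for n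
    by (auto simp: h_def divide_simps)
  define q where "q n x = (f (x + h n *\<^sub>R b) - f x) / h n" for n x
  have cont: "continuous_on UNIV f"
    using f by (intro continuous_at_imp_continuous_on) (auto intro: has_derivative_continuous)
  have "integrable lborel (\<lambda>x. indicat_real K x *\<^sub>R f x)"
    using K cont by (intro borel_integrable_compact continuous_on_subset[OF cont]) auto
  moreover have "(\<lambda>x. indicat_real K x *\<^sub>R f x) = f"
    using K by (auto simp: indicator_def fun_eq_iff)
  ultimately have int: "integrable lborel f" by simp
  have q_int: "(LINT x|lborel. q n x) = 0" for n
    using int integral_lborel_translate[OF int, of "h n *\<^sub>R b"] by (simp add: q_def)
  have line: "((\<lambda>s. f (x + s *\<^sub>R b)) has_field_derivative f' (x + s *\<^sub>R b) b) (at s)" for x s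
  proof -
    have "((\<lambda>s. x + s *\<^sub>R b) has_derivative (\<lambda>s. s *\<^sub>R b)) (at s)"
      by (auto intro!: derivative_eq_intros)
    from has_derivative_compose[OF this f]
    have "((\<lambda>s. f (x + s *\<^sub>R b)) has_derivative (\<lambda>t. f' (x + s *\<^sub>R b) (t *\<^sub>R b))) (at s)" .
    moreover have "f' (x + s *\<^sub>R b) (t *\<^sub>R b) = f' (x + s *\<^sub>R b) b * t" for t
      using has_derivative_linear[OF f] by (simp add: linear_cmul)
    ultimately show ?thesis
      by (simp add: has_field_derivative_def)
  qed
  have f'0: "f' x b = 0" if "x \<notin> K" for x
    unfolding frechet_derivative_at[OF f]
    by (rule frechet_derivative_eq_0_outside[where K = K]) (use K that in \<open>auto intro: compact_imp_closed\<close>)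
  have "bounded ((\<lambda>x. f' x b) ` K)"
    by (intro compact_imp_bounded compact_continuous_image K continuous_on_subset[OF f']) simp
  then obtain B where B: "B > 0" "\<And>x. x \<in> K \<Longrightarrow> \<bar>f' x b\<bar> \<le> B"
    unfolding bounded_pos by auto
  then have B': "\<bar>f' x b\<bar> \<le> B" for x
    using f'0[of x] by (cases "x \<in> K") auto
  obtain R where R: "\<And>x. x \<in> K \<Longrightarrow> norm x \<le> R"
    using compact_imp_bounded[OF K(1)] by (auto simp: bounded_iff)
  \<comment> \<open>Since \<open>h n \<le> 1\<close>, a point outside this ball and its translate by
    \<open>h n *\<^sub>R b\<close> both miss \<open>K\<close>; one ball serves all
    \<open>n\<close>.\<close>
  let ?C = "cball (0::'a) (R + norm b)"
  have bound: "\<bar>q n x\<bar> \<le> B * indicat_real ?C x" for n x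
  proof (cases "x \<in> ?C")
    case True
    \<comment> \<open>The mean value theorem turns the quotient into a value of the derivative, so
      \<open>B\<close> bounds it uniformly in \<open>n\<close>.\<close>
    obtain z where "f (x + h n *\<^sub>R b) - f (x + 0 *\<^sub>R b) = (h n - 0) * f' (x + z *\<^sub>R b) b"
      using MVT2[OF h(1)[of n], of "\<lambda>s. f (x + s *\<^sub>R b)" "\<lambda>s. f' (x + s *\<^sub>R b) b"] line by metis
    then have "q n x = f' (x + z *\<^sub>R b) b"
      using h(1)[of n] by (simp add: q_def)
    then show ?thesis using True B' by simp
  next
    case False
    have "norm (h n *\<^sub>R b) \<le> norm b"
      using h[of n] by (simp add: mult_left_le_one_le)
    moreover have "norm x \<le> norm (x + h n *\<^sub>R b) + norm (h n *\<^sub>R b)"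
      using norm_triangle_ineq4[of "x + h n *\<^sub>R b" "h n *\<^sub>R b"] by simp
    ultimately have "x \<notin> K" "x + h n *\<^sub>R b \<notin> K"
      using False R[of x] R[of "x + h n *\<^sub>R b"] norm_ge_zero[of b] by auto
    then show ?thesis using False K by (simp add: q_def)
  qed
  have lim: "(\<lambda>n. q n x) \<longlonglongrightarrow> f' x b" for x
  proof -
    have "((\<lambda>t. (f (x + t *\<^sub>R b) - f x) / t) \<longlongrightarrow> f' x b) (at 0)"
      using line[of x 0] by (simp add: DERIV_def)
    moreover have "filterlim h (at 0) sequentially"
      unfolding h_def by real_asymp
    ultimately show ?thesis
      unfolding q_def by (rule filterlim_compose)
  qed
  have "(\<lambda>n. LINT x|lborel. q n x) \<longlonglongrightarrow> (LINT x|lborel. f' x b)"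
  proof (rule integral_dominated_convergence)
    show "(\<lambda>x. f' x b) \<in> borel_measurable lborel"
      using f' by (simp add: borel_measurable_continuous_onI)
    have [measurable]: "f \<in> borel_measurable borel"
      using cont by (rule borel_measurable_continuous_onI)
    show "q n \<in> borel_measurable lborel" for n
      unfolding q_def by measurable
    show "integrable lborel (\<lambda>x. B * indicat_real ?C x)"
      using emeasure_lborel_cball_finite[of "0::'a" "R + norm b"]
      by (intro integrable_mult_right integrable_real_indicator) auto
  qed (use bound lim in auto)
  then show ?thesis
    by (simp add: q_int LIMSEQ_const_iff)
qed

text \<open>The derivative vanishes off \<open>K\<close>, which lies in \<open>\<Omega>\<close>, so
  integrating over \<open>\<Omega>\<close> or over the whole space is the same.\<close>

lemma integral_on_partial_derivative_eq_0:
  fixes f :: "'a::euclidean_space \<Rightarrow> real"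
  assumes f: "\<And>x. (f has_derivative f' x) (at x)" and f': "continuous_on UNIV (\<lambda>x. f' x b)"
    and K: "compact K" "K \<subseteq> \<Omega>" "\<And>x. x \<notin> K \<Longrightarrow> f x = 0" and \<Omega>: "\<Omega> \<in> sets lebesgue"
  shows "(LINT x|lebesgue_on \<Omega>. f' x b) = 0"
proof -
  have "f' x b = 0" if "x \<notin> K" for x
    unfolding frechet_derivative_at[OF f]
    by (rule frechet_derivative_eq_0_outside[where K = K]) (use K that in \<open>auto intro: compact_imp_closed\<close>)
  then have "(\<lambda>x. indicat_real \<Omega> x *\<^sub>R f' x b) = (\<lambda>x. f' x b)"
    using K by (auto simp: fun_eq_iff indicator_def)
  then have "(LINT x|lebesgue_on \<Omega>. f' x b) = (LINT x|lebesgue. f' x b)"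
    using \<Omega> by (simp add: integral_restrict_space)
  also have "\<dots> = (LINT x|lborel. f' x b)"
    using f' by (intro integral_completion) (simp add: borel_measurable_continuous_onI)
  finally show ?thesis
    using integral_partial_derivative_eq_0[OF f f' K(1,3)] by simp
qed

text \<open>Integration by parts: the partial derivatives of the product of two test functions
  integrate to 0, which shifts the derivative from one factor to the other in each
  coordinate.\<close>

lemma has_weak_gradient_test_function:
  assumes \<Omega>: "\<Omega> \<in> sets lebesgue" and \<phi>: "\<phi> \<in> test_functions \<Omega>"
  shows "has_weak_gradient \<Omega> \<phi> (grad \<phi>)"
  unfolding has_weak_gradient_def
proof (intro conjI ballI)
  note c[continuous_intros] = continuous_test_function[OF \<phi>] test_function_derivative(2)[OF \<phi>]
  note d = test_function_derivative(1)[OF \<phi>]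
  show "locally_integrable \<Omega> \<phi>"
    using c(1) by (rule locally_integrable_continuous)
  show "locally_integrable \<Omega> (grad \<phi>)"
    unfolding grad_def by (intro locally_integrable_continuous continuous_intros)
  fix \<psi> assume \<psi>: "\<psi> \<in> test_functions \<Omega>"
  note c'[continuous_intros] = continuous_test_function[OF \<psi>] test_function_derivative(2)[OF \<psi>]
  note d' = test_function_derivative(1)[OF \<psi>]
  from \<phi> obtain K where K: "compact K" "K \<subseteq> \<Omega>" "\<And>x. x \<notin> K \<Longrightarrow> \<phi> x = 0"
    using test_functionsD by blast
  have z: "frechet_derivative \<phi> (at x) b = 0" if "x \<notin> K" for x b
    by (rule frechet_derivative_eq_0_outside[where K = K]) (use K that in \<open>auto intro: compact_imp_closed\<close>)
  have int: "integrable (lebesgue_on \<Omega>) (\<lambda>x. \<phi> x * frechet_derivative \<psi> (at x) b)"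
    "integrable (lebesgue_on \<Omega>) (\<lambda>x. \<psi> x * frechet_derivative \<phi> (at x) b)" if "b \<in> Basis" for b
    using that by (auto intro!: integrable_continuous_compact_support[OF \<Omega> _ K(1,2)] continuous_intros simp: K z)
  have parts: "(LINT x|lebesgue_on \<Omega>. \<phi> x * frechet_derivative \<psi> (at x) b)
      = - (LINT x|lebesgue_on \<Omega>. \<psi> x * frechet_derivative \<phi> (at x) b)" if b: "b \<in> Basis" for b
  proof -
    have "(LINT x|lebesgue_on \<Omega>. \<phi> x * frechet_derivative \<psi> (at x) b + frechet_derivative \<phi> (at x) b * \<psi> x) = 0"
      using K b by (intro integral_on_partial_derivative_eq_0[OF has_derivative_mult[OF d d'] _ K(1,2) _ \<Omega>]
          continuous_intros) auto
    then show ?thesis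
      using int[OF b] by (simp add: mult.commute)
  qed
  have "(LINT x|lebesgue_on \<Omega>. \<phi> x *\<^sub>R grad \<psi> x)
      = (\<Sum>b\<in>Basis. (LINT x|lebesgue_on \<Omega>. \<phi> x * frechet_derivative \<psi> (at x) b) *\<^sub>R b)"
    using int(1) by (simp add: grad_def scaleR_sum_right)
  also have "\<dots> = - (\<Sum>b\<in>Basis. (LINT x|lebesgue_on \<Omega>. \<psi> x * frechet_derivative \<phi> (at x) b) *\<^sub>R b)"
    by (simp add: parts sum_negf)
  also have "\<dots> = - (LINT x|lebesgue_on \<Omega>. \<psi> x *\<^sub>R grad \<phi> x)"
    using int(2) by (simp add: grad_def scaleR_sum_right)
  finally show "(LINT x|lebesgue_on \<Omega>. \<phi> x *\<^sub>R grad \<psi> x) = - (LINT x|lebesgue_on \<Omega>. \<psi> x *\<^sub>R grad \<phi> x)" .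
qed

section \<open>Square integrable functions and representatives of weak gradients\<close>

lemma borel_measurable_lebesgue_on_AE:
  fixes f g :: "'a::euclidean_space \<Rightarrow> 'b::euclidean_space"
  assumes \<Omega>: "\<Omega> \<in> sets lebesgue" and f: "f \<in> borel_measurable (lebesgue_on \<Omega>)"
    and ae: "AE x in lebesgue_on \<Omega>. f x = g x"
  shows "g \<in> borel_measurable (lebesgue_on \<Omega>)"
proof -
  have "AE x in lebesgue. x \<in> \<Omega> \<longrightarrow> f x = g x"
    using ae \<Omega> by (simp add: AE_restrict_space_iff)
  \<comment> \<open>Completeness of Lebesgue measure gives measurability of anything almost
    everywhere equal to a measurable function; it is applied on the whole space after extension by
    zero.\<close>
  then have "AE x in lebesgue. (if x \<in> \<Omega> then f x else 0) = (if x \<in> \<Omega> then g x else 0)"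
    by eventually_elim auto
  from borel_measurable_AE[OF borel_measurable_if_I[OF f \<Omega>] this] show ?thesis
    by (rule borel_measurable_if_D)
qed

lemma L2D:
  assumes "f \<in> L2 \<Omega>"
  shows "f \<in> borel_measurable (lebesgue_on \<Omega>)" "integrable (lebesgue_on \<Omega>) (\<lambda>x. (norm (f x))\<^sup>2)"
  using assms unfolding L2_def by blast+

lemma L2_cong_AE:
  fixes f g :: "'a::euclidean_space \<Rightarrow> 'b::euclidean_space"
  assumes \<Omega>: "\<Omega> \<in> sets lebesgue" and f: "f \<in> L2 \<Omega>" and ae: "AE x in lebesgue_on \<Omega>. f x = g x"
  shows "g \<in> L2 \<Omega>"
    and "(LINT x|lebesgue_on \<Omega>. (norm (g x))\<^sup>2) = (LINT x|lebesgue_on \<Omega>. (norm (f x))\<^sup>2)"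
proof -
  have f': "f \<in> borel_measurable (lebesgue_on \<Omega>)" "integrable (lebesgue_on \<Omega>) (\<lambda>x. (norm (f x))\<^sup>2)"
    using L2D[OF f] by blast+
  then have g: "g \<in> borel_measurable (lebesgue_on \<Omega>)"
    using borel_measurable_lebesgue_on_AE[OF \<Omega> _ ae] by simp
  have ae2: "AE x in lebesgue_on \<Omega>. (norm (f x))\<^sup>2 = (norm (g x))\<^sup>2"
    using ae by eventually_elim simp
  have "(\<lambda>x. (norm (f x))\<^sup>2) \<in> borel_measurable (lebesgue_on \<Omega>)"
    using f' by auto
  moreover have g2: "(\<lambda>x. (norm (g x))\<^sup>2) \<in> borel_measurable (lebesgue_on \<Omega>)"
    using g by measurable
  ultimately show "(LINT x|lebesgue_on \<Omega>. (norm (g x))\<^sup>2) = (LINT x|lebesgue_on \<Omega>. (norm (f x))\<^sup>2)"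
    using ae2 by (intro integral_cong_AE[symmetric])
  show "g \<in> L2 \<Omega>"
    using integrable_cong_AE_imp[OF f'(2) g2] ae2 g by (auto simp: L2_def)
qed

lemma L2_diff:
  fixes f g :: "'a::euclidean_space \<Rightarrow> 'b::euclidean_space"
  assumes "f \<in> L2 \<Omega>" "g \<in> L2 \<Omega>"
  shows "(\<lambda>x. f x - g x) \<in> L2 \<Omega>"
proof -
  have [measurable]: "f \<in> borel_measurable (lebesgue_on \<Omega>)" "g \<in> borel_measurable (lebesgue_on \<Omega>)"
    by (rule L2D(1)[OF assms(1)] L2D(1)[OF assms(2)])+
  have bound: "(norm (a - b))\<^sup>2 \<le> 2 * (norm a)\<^sup>2 + 2 * (norm b)\<^sup>2" for a b :: 'b
  proof -
    have "(norm (a - b))\<^sup>2 \<le> (norm a + norm b)\<^sup>2"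
      by (intro power_mono norm_triangle_ineq4) simp
    moreover have "0 \<le> (norm a - norm b)\<^sup>2"
      by simp
    ultimately show ?thesis
      by (simp add: power2_eq_square algebra_simps)
  qed
  have "integrable (lebesgue_on \<Omega>) (\<lambda>x. (norm (f x - g x))\<^sup>2)"
  proof (rule Bochner_Integration.integrable_bound)
    show "integrable (lebesgue_on \<Omega>) (\<lambda>x. 2 * (norm (f x))\<^sup>2 + 2 * (norm (g x))\<^sup>2)"
      using L2D(2)[OF assms(1)] L2D(2)[OF assms(2)] by simp
    show "(\<lambda>x. (norm (f x - g x))\<^sup>2) \<in> borel_measurable (lebesgue_on \<Omega>)"
      by measurable
  qed (simp add: bound)
  then show ?thesis by (simp add: L2_def)
qed

lemma L2_scale:
  fixes f :: "'a::euclidean_space \<Rightarrow> 'b::euclidean_space"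
  assumes "f \<in> L2 \<Omega>"
  shows "(\<lambda>x. t *\<^sub>R f x) \<in> L2 \<Omega>"
proof -
  have [measurable]: "f \<in> borel_measurable (lebesgue_on \<Omega>)"
    by (rule L2D(1)[OF assms])
  have "(\<lambda>x. t *\<^sub>R f x) \<in> borel_measurable (lebesgue_on \<Omega>)"
    by measurable
  then show ?thesis
    using L2D(2)[OF assms] by (simp add: L2_def power_mult_distrib)
qed

text \<open>All weak gradients agree almost everywhere, so norms may be computed from whichever
  square integrable one is at hand.\<close>

lemma weak_grad_L2:
  assumes \<Omega>: "open \<Omega>" and g: "has_weak_gradient \<Omega> u g" "g \<in> L2 \<Omega>"
  shows "weak_grad \<Omega> u \<in> L2 \<Omega>"
    and "(LINT x|lebesgue_on \<Omega>. (norm (weak_grad \<Omega> u x))\<^sup>2) = (LINT x|lebesgue_on \<Omega>. (norm (g x))\<^sup>2)"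
proof -
  have "\<Omega> \<in> sets lebesgue" "AE x in lebesgue_on \<Omega>. g x = weak_grad \<Omega> u x"
    using \<Omega> weak_grad_AE_eq[OF \<Omega> g(1)] by auto
  from L2_cong_AE[OF this(1) g(2) this(2)] show "weak_grad \<Omega> u \<in> L2 \<Omega>"
    and "(LINT x|lebesgue_on \<Omega>. (norm (weak_grad \<Omega> u x))\<^sup>2) = (LINT x|lebesgue_on \<Omega>. (norm (g x))\<^sup>2)"
    by auto
qed

lemma H1_weak_grad:
  assumes "open \<Omega>" "u \<in> H1 \<Omega>"
  shows "u \<in> L2 \<Omega>" "has_weak_gradient \<Omega> u (weak_grad \<Omega> u)" "weak_grad \<Omega> u \<in> L2 \<Omega>"
proof -
  obtain g where u: "u \<in> L2 \<Omega>" and g: "has_weak_gradient \<Omega> u g" "g \<in> L2 \<Omega>"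
    using assms(2) unfolding H1_def by blast
  show "u \<in> L2 \<Omega>" "has_weak_gradient \<Omega> u (weak_grad \<Omega> u)" "weak_grad \<Omega> u \<in> L2 \<Omega>"
    by (rule u has_weak_gradient_weak_grad[OF g(1)] weak_grad_L2(1)[OF assms(1) g])+
qed

lemma H1I: "u \<in> L2 \<Omega> \<Longrightarrow> has_weak_gradient \<Omega> u g \<Longrightarrow> g \<in> L2 \<Omega> \<Longrightarrow> u \<in> H1 \<Omega>"
  unfolding H1_def by blast

lemma test_function_L2:
  assumes \<Omega>: "\<Omega> \<in> sets lebesgue" and \<phi>: "\<phi> \<in> test_functions \<Omega>"
  shows "\<phi> \<in> L2 \<Omega>" "grad \<phi> \<in> L2 \<Omega>"
proof -
  note c[continuous_intros] = continuous_test_function[OF \<phi>] test_function_derivative(2)[OF \<phi>]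
  from \<phi> obtain K where K: "compact K" "K \<subseteq> \<Omega>" "\<And>x. x \<notin> K \<Longrightarrow> \<phi> x = 0"
    using test_functionsD by blast
  have g: "continuous_on UNIV (grad \<phi>)"
    unfolding grad_def by (intro continuous_intros)
  have z: "frechet_derivative \<phi> (at x) b = 0" if "x \<notin> K" for x b
    by (rule frechet_derivative_eq_0_outside[where K = K]) (use K that in \<open>auto intro: compact_imp_closed\<close>)
  have "integrable (lebesgue_on \<Omega>) (\<lambda>x. (norm (\<phi> x))\<^sup>2)"
    by (rule integrable_continuous_compact_support[OF \<Omega> _ K(1,2)]) (auto simp: K intro!: continuous_intros)
  moreover have "integrable (lebesgue_on \<Omega>) (\<lambda>x. (norm (grad \<phi> x))\<^sup>2)"
    by (rule integrable_continuous_compact_support[OF \<Omega> _ K(1,2)])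
      (auto simp: z grad_def[of _ _] intro!: continuous_intros g)
  ultimately show "\<phi> \<in> L2 \<Omega>" "grad \<phi> \<in> L2 \<Omega>"
    unfolding L2_def
    by (simp_all add: borel_measurable_lebesgue_onI borel_measurable_continuous_onI c(1) g)
qed

text \<open>The distances in the definition of \<open>H10\<close> involve \<open>weak_grad\<close>
  of a difference; this provides an explicit gradient to compute them with.\<close>

lemma H1_diff_test_function:
  assumes \<Omega>: "open \<Omega>" and u: "u \<in> H1 \<Omega>" and \<phi>: "\<phi> \<in> test_functions \<Omega>"
  shows "(\<lambda>x. u x - \<phi> x) \<in> H1 \<Omega>"
    and "has_weak_gradient \<Omega> (\<lambda>x. u x - \<phi> x) (\<lambda>x. weak_grad \<Omega> u x - grad \<phi> x)"
    and "(\<lambda>x. weak_grad \<Omega> u x - grad \<phi> x) \<in> L2 \<Omega>"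
proof -
  have \<Omega>': "\<Omega> \<in> sets lebesgue"
    using \<Omega> by simp
  show g: "has_weak_gradient \<Omega> (\<lambda>x. u x - \<phi> x) (\<lambda>x. weak_grad \<Omega> u x - grad \<phi> x)"
    by (rule has_weak_gradient_diff[OF \<Omega>' H1_weak_grad(2)[OF \<Omega> u] has_weak_gradient_test_function[OF \<Omega>' \<phi>]])
  show h: "(\<lambda>x. weak_grad \<Omega> u x - grad \<phi> x) \<in> L2 \<Omega>"
    by (rule L2_diff[OF H1_weak_grad(3)[OF \<Omega> u] test_function_L2(2)[OF \<Omega>' \<phi>]])
  have "(\<lambda>x. u x - \<phi> x) \<in> L2 \<Omega>"
    by (rule L2_diff[OF H1_weak_grad(1)[OF \<Omega> u] test_function_L2(1)[OF \<Omega>' \<phi>]])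
  then show "(\<lambda>x. u x - \<phi> x) \<in> H1 \<Omega>"
    using g h by (rule H1I)
qed

subsection \<open>Nondegeneracy and homogeneity of the norms\<close>

text \<open>Integrate the derivative of \<open>(x \<bullet> b) * (\<phi> x)\<^sup>2\<close> in direction \<open>b\<close>, and absorb half of
  \<open>(\<phi> x)\<^sup>2\<close> by Young's inequality.\<close>

lemma poincare_test_function:
  fixes \<phi> :: "'a::euclidean_space \<Rightarrow> real"
  assumes \<Omega>: "\<Omega> \<in> sets lebesgue" and R: "\<And>x. x \<in> \<Omega> \<Longrightarrow> norm x \<le> R" and \<phi>: "\<phi> \<in> test_functions \<Omega>"
  shows "(LINT x|lebesgue_on \<Omega>. (\<phi> x)\<^sup>2) \<le> 4 * R\<^sup>2 * (LINT x|lebesgue_on \<Omega>. (norm (grad \<phi> x))\<^sup>2)"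
proof -
  obtain b :: 'a where b: "b \<in> Basis"
    using nonempty_Basis by blast
  let ?d = "\<lambda>x. frechet_derivative \<phi> (at x) b"
  note c[continuous_intros] = continuous_test_function[OF \<phi>] test_function_derivative(2)[OF \<phi> b]
  note d = test_function_derivative(1)[OF \<phi>]
  from \<phi> obtain K where K: "compact K" "K \<subseteq> \<Omega>" "\<And>x. x \<notin> K \<Longrightarrow> \<phi> x = 0"
    using test_functionsD by blast
  have int: "integrable (lebesgue_on \<Omega>) (\<lambda>x. (\<phi> x)\<^sup>2)" "integrable (lebesgue_on \<Omega>) (\<lambda>x. (norm (grad \<phi> x))\<^sup>2)"
    using L2D(2)[OF test_function_L2(1)[OF \<Omega> \<phi>]] L2D(2)[OF test_function_L2(2)[OF \<Omega> \<phi>]] by simp_all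
  have int': "integrable (lebesgue_on \<Omega>) (\<lambda>x. (x \<bullet> b) * (\<phi> x * ?d x))"
    by (rule integrable_continuous_compact_support[OF \<Omega> _ K(1,2)]) (auto simp: K intro!: continuous_intros)
  have eq: "(x \<bullet> b) * (\<phi> x * ?d x + ?d x * \<phi> x) + (b \<bullet> b) * (\<phi> x * \<phi> x)
      = 2 * ((x \<bullet> b) * (\<phi> x * ?d x)) + (\<phi> x)\<^sup>2" for x
    using b by (simp add: power2_eq_square algebra_simps)
  have der: "((\<lambda>x. (x \<bullet> b) * (\<phi> x * \<phi> x)) has_derivative
      (\<lambda>h. (x \<bullet> b) * (\<phi> x * frechet_derivative \<phi> (at x) h + frechet_derivative \<phi> (at x) h * \<phi> x)
        + (h \<bullet> b) * (\<phi> x * \<phi> x))) (at x)" for x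
    by (intro has_derivative_mult d) (auto intro!: derivative_eq_intros)
  have "(LINT x|lebesgue_on \<Omega>. (x \<bullet> b) * (\<phi> x * ?d x + ?d x * \<phi> x) + (b \<bullet> b) * (\<phi> x * \<phi> x)) = 0"
    by (rule integral_on_partial_derivative_eq_0[OF der _ K(1,2) _ \<Omega>])
      (auto simp: K intro!: continuous_intros)
  then have "(LINT x|lebesgue_on \<Omega>. (\<phi> x)\<^sup>2) = - 2 * (LINT x|lebesgue_on \<Omega>. (x \<bullet> b) * (\<phi> x * ?d x))"
    unfolding eq using int int' by simp
  also have "\<dots> = (LINT x|lebesgue_on \<Omega>. - 2 * ((x \<bullet> b) * (\<phi> x * ?d x)))"
    by simp
  also have "\<dots> \<le> (LINT x|lebesgue_on \<Omega>. 1 / 2 * (\<phi> x)\<^sup>2 + 2 * R\<^sup>2 * (norm (grad \<phi> x))\<^sup>2)"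
  proof (rule integral_mono)
    fix x assume "x \<in> space (lebesgue_on \<Omega>)"
    then have x: "norm x \<le> R" using R by simp
    have "?d x = grad \<phi> x \<bullet> b"
      using b by (simp add: grad_def inner_sum_left inner_Basis if_distrib cong: if_cong)
    then have "\<bar>?d x\<bar> \<le> norm (grad \<phi> x)"
      using b Basis_le_norm by metis
    moreover have "\<bar>x \<bullet> b\<bar> \<le> R"
      using x b Basis_le_norm order_trans by metis
    ultimately have "\<bar>(x \<bullet> b) * ?d x\<bar> \<le> R * norm (grad \<phi> x)"
      unfolding abs_mult by (intro mult_mono) auto
    then have "((x \<bullet> b) * ?d x)\<^sup>2 \<le> (R * norm (grad \<phi> x))\<^sup>2"
      by (metis abs_ge_zero power2_abs power_mono)
    \<comment> \<open>Half of this square is Young's inequality with weights 1/2 and 2. Absorbing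
      the 1/2 on the left later doubles \<open>2 * R\<^sup>2\<close> to
      \<open>4 * R\<^sup>2\<close>.\<close>
    moreover have "0 \<le> (\<phi> x + 2 * ((x \<bullet> b) * ?d x))\<^sup>2" by simp
    ultimately show "- 2 * ((x \<bullet> b) * (\<phi> x * ?d x)) \<le> 1 / 2 * (\<phi> x)\<^sup>2 + 2 * R\<^sup>2 * (norm (grad \<phi> x))\<^sup>2"
      by (simp add: power2_eq_square algebra_simps)
  qed (use int int' in auto)
  also have "\<dots> = 1 / 2 * (LINT x|lebesgue_on \<Omega>. (\<phi> x)\<^sup>2) + 2 * R\<^sup>2 * (LINT x|lebesgue_on \<Omega>. (norm (grad \<phi> x))\<^sup>2)"
    using int by simp
  finally show ?thesis by simp
qed

text \<open>If the weak gradient of \<open>u\<close> vanishes, that of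
  \<open>u x - \<phi> n x\<close> is \<open>- grad (\<phi> n) x\<close>. The \<open>H1\<close>
  distance then controls the gradient of \<open>\<phi> n\<close> and, by Poincare,
  \<open>\<phi> n\<close> itself, so both summands of \<open>u = (u - \<phi> n) + \<phi> n\<close>
  tend to 0 in \<open>L2\<close>.\<close>

lemma H10_AE_eq_0:
  fixes u :: "'a::euclidean_space \<Rightarrow> real"
  assumes \<Omega>: "open \<Omega>" "bounded \<Omega>" and u: "u \<in> H10 \<Omega>" and 0: "H10_norm \<Omega> u = 0"
  shows "AE x in lebesgue_on \<Omega>. u x = 0"
proof -
  let ?M = "lebesgue_on \<Omega>"
  have \<Omega>': "\<Omega> \<in> sets lebesgue"
    using \<Omega> by simp
  obtain R where R: "\<And>x. x \<in> \<Omega> \<Longrightarrow> norm x \<le> R"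
    using \<Omega> by (auto simp: bounded_iff)
  have u1: "u \<in> H1 \<Omega>" using u by (simp add: H10_def)
  note w = H1_weak_grad[OF \<Omega>(1) u1]
  obtain \<phi> where \<phi>: "\<And>n. \<phi> n \<in> test_functions \<Omega>"
    and lim: "(\<lambda>n. H1_norm \<Omega> (\<lambda>x. u x - \<phi> n x)) \<longlonglongrightarrow> 0"
    using u by (auto simp: H10_def)
  have int_u: "integrable ?M (\<lambda>x. (u x)\<^sup>2)"
    using L2D(2)[OF w(1)] by simp
  have "(LINT x|?M. (norm (weak_grad \<Omega> u x))\<^sup>2) = 0"
    using 0 by (simp add: H10_norm_def)
  then have "AE x in ?M. (norm (weak_grad \<Omega> u x))\<^sup>2 = 0"
    by (subst (asm) integral_nonneg_eq_0_iff_AE[OF L2D(2)[OF w(3)]]) simp_all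
  then have grad0: "AE x in ?M. weak_grad \<Omega> u x = 0"
    by eventually_elim simp
  \<comment> \<open>The 2 comes from bounding the square of a sum by twice the sum of the squares,
    and \<open>8 * R\<^sup>2\<close> is twice the Poincare constant.\<close>
  have bound: "(LINT x|?M. (u x)\<^sup>2) \<le> (2 + 8 * R\<^sup>2) * (H1_norm \<Omega> (\<lambda>x. u x - \<phi> n x))\<^sup>2" for n
  proof -
    let ?v = "\<lambda>x. u x - \<phi> n x"
    let ?g = "\<lambda>x. weak_grad \<Omega> u x - grad (\<phi> n) x"
    note h = H1_diff_test_function[OF \<Omega>(1) u1 \<phi>[of n]]
    note t = test_function_L2[OF \<Omega>' \<phi>[of n]]
    have int: "integrable ?M (\<lambda>x. (?v x)\<^sup>2)" "integrable ?M (\<lambda>x. (\<phi> n x)\<^sup>2)"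
      using L2D(2)[OF H1_weak_grad(1)[OF \<Omega>(1) h(1)]] L2D(2)[OF t(1)] by simp_all
    have ae: "AE x in ?M. ?g x = - grad (\<phi> n) x"
      using grad0 by eventually_elim simp
    have grad: "(LINT x|?M. (norm (grad (\<phi> n) x))\<^sup>2) = (LINT x|?M. (norm (weak_grad \<Omega> ?v x))\<^sup>2)"
      using L2_cong_AE(2)[OF \<Omega>' h(3) ae] weak_grad_L2(2)[OF \<Omega>(1) h(2,3)]
      unfolding norm_minus_cancel by (rule trans[OF _ sym])
    have "(LINT x|?M. (u x)\<^sup>2) \<le> (LINT x|?M. 2 * (?v x)\<^sup>2 + 2 * (\<phi> n x)\<^sup>2)"
    proof (rule integral_mono[OF int_u])
      fix x
      have "0 \<le> (u x - 2 * \<phi> n x)\<^sup>2" by simp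
      then show "(u x)\<^sup>2 \<le> 2 * (?v x)\<^sup>2 + 2 * (\<phi> n x)\<^sup>2"
        by (simp add: power2_eq_square algebra_simps)
    qed (use int in auto)
    also have "\<dots> = 2 * (LINT x|?M. (?v x)\<^sup>2) + 2 * (LINT x|?M. (\<phi> n x)\<^sup>2)"
      using int by simp
    also have "\<dots> \<le> 2 * (LINT x|?M. (?v x)\<^sup>2) + 8 * R\<^sup>2 * (LINT x|?M. (norm (weak_grad \<Omega> ?v x))\<^sup>2)"
      using poincare_test_function[OF \<Omega>' R \<phi>[of n]] grad by simp
    also have "\<dots> \<le> (2 + 8 * R\<^sup>2) * ((LINT x|?M. (?v x)\<^sup>2) + (LINT x|?M. (norm (weak_grad \<Omega> ?v x))\<^sup>2))"
      by (simp add: algebra_simps)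
    also have "\<dots> = (2 + 8 * R\<^sup>2) * (H1_norm \<Omega> ?v)\<^sup>2"
      by (simp add: H1_norm_def)
    finally show ?thesis .
  qed
  have "(\<lambda>n. (2 + 8 * R\<^sup>2) * (H1_norm \<Omega> (\<lambda>x. u x - \<phi> n x))\<^sup>2) \<longlonglongrightarrow> (2 + 8 * R\<^sup>2) * 0\<^sup>2"
    by (intro tendsto_intros lim)
  then have "(LINT x|?M. (u x)\<^sup>2) \<le> 0"
    using bound by (intro LIMSEQ_le_const[where X = "\<lambda>n. (2 + 8 * R\<^sup>2) * (H1_norm \<Omega> (\<lambda>x. u x - \<phi> n x))\<^sup>2"]) auto
  then have "(LINT x|?M. (u x)\<^sup>2) = 0"
    by (simp add: antisym)
  then have "AE x in ?M. (u x)\<^sup>2 = 0"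
    using int_u by (subst (asm) integral_nonneg_eq_0_iff_AE) auto
  then show ?thesis
    by eventually_elim simp
qed

text \<open>The weak gradient of the multiple is a separate choice and need not literally be
  \<open>t\<close> times that of \<open>u\<close>; by uniqueness the two agree almost everywhere,
  which is all the norms see.\<close>

lemma H1_scale:
  assumes \<Omega>: "open \<Omega>" and u: "u \<in> H1 \<Omega>"
  shows "(\<lambda>x. t * u x) \<in> H1 \<Omega>"
    and "H10_norm \<Omega> (\<lambda>x. t * u x) = \<bar>t\<bar> * H10_norm \<Omega> u"
    and "H1_norm \<Omega> (\<lambda>x. t * u x) = \<bar>t\<bar> * H1_norm \<Omega> u"
proof -
  note w = H1_weak_grad[OF \<Omega> u]
  note wt = has_weak_gradient_scale[OF w(2), of t]
  note Lt = L2_scale[OF w(3), of t]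
  show "(\<lambda>x. t * u x) \<in> H1 \<Omega>"
    using L2_scale[OF w(1), of t] H1I[OF _ wt Lt] by simp
  have eq: "(LINT x|lebesgue_on \<Omega>. (norm (weak_grad \<Omega> (\<lambda>x. t * u x) x))\<^sup>2)
      = t\<^sup>2 * (LINT x|lebesgue_on \<Omega>. (norm (weak_grad \<Omega> u x))\<^sup>2)"
    unfolding weak_grad_L2(2)[OF \<Omega> wt Lt] by (simp add: power_mult_distrib)
  show "H10_norm \<Omega> (\<lambda>x. t * u x) = \<bar>t\<bar> * H10_norm \<Omega> u"
    unfolding H10_norm_def eq by (simp add: real_sqrt_mult)
  show "H1_norm \<Omega> (\<lambda>x. t * u x) = \<bar>t\<bar> * H1_norm \<Omega> u"
    unfolding H1_norm_def eq by (simp add: power_mult_distrib real_sqrt_mult flip: distrib_left)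
qed

lemma test_functions_scale: "\<phi> \<in> test_functions \<Omega> \<Longrightarrow> (\<lambda>x. t * \<phi> x) \<in> test_functions \<Omega>"
  by (erule test_functions_mult) (rule C_diff_const)

text \<open>Scaling the approximating test functions by the same \<open>t\<close> multiplies all
  distances by \<open>\<bar>t\<bar>\<close>.\<close>

lemma H10_nonzero_scale:
  assumes \<Omega>: "open \<Omega>" and u: "u \<in> H10_nonzero \<Omega>" and t: "t \<noteq> 0"
  shows "(\<lambda>x. t * u x) \<in> H10_nonzero \<Omega>"
proof -
  have u1: "u \<in> H1 \<Omega>" and nz: "\<not> (AE x in lebesgue_on \<Omega>. u x = 0)"
    using u by (auto simp: H10_nonzero_def H10_def)
  obtain \<phi> where \<phi>: "\<And>n. \<phi> n \<in> test_functions \<Omega>"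
    and lim: "(\<lambda>n. H1_norm \<Omega> (\<lambda>x. u x - \<phi> n x)) \<longlonglongrightarrow> 0"
    using u by (auto simp: H10_nonzero_def H10_def)
  have "(\<lambda>n. \<bar>t\<bar> * H1_norm \<Omega> (\<lambda>x. u x - \<phi> n x)) \<longlonglongrightarrow> \<bar>t\<bar> * 0"
    by (intro tendsto_intros lim)
  moreover have "H1_norm \<Omega> (\<lambda>x. t * u x - t * \<phi> n x) = \<bar>t\<bar> * H1_norm \<Omega> (\<lambda>x. u x - \<phi> n x)" for n
    using H1_scale(3)[OF \<Omega> H1_diff_test_function(1)[OF \<Omega> u1 \<phi>[of n]], of t]
    by (simp add: right_diff_distrib)
  ultimately have "(\<lambda>n. H1_norm \<Omega> (\<lambda>x. t * u x - t * \<phi> n x)) \<longlonglongrightarrow> 0"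
    by simp
  moreover have "\<forall>n. (\<lambda>x. t * \<phi> n x) \<in> test_functions \<Omega>"
    using test_functions_scale[OF \<phi>] by blast
  ultimately have "(\<lambda>x. t * u x) \<in> H10 \<Omega>"
    using H1_scale(1)[OF \<Omega> u1, of t] unfolding H10_def
    by (intro CollectI conjI exI[of _ "\<lambda>n x. t * \<phi> n x"]) simp_all
  then show ?thesis
    using nz t by (simp add: H10_nonzero_def)
qed

lemma H10_norm_pos:
  assumes "open \<Omega>" "bounded \<Omega>" "u \<in> H10_nonzero \<Omega>"
  shows "H10_norm \<Omega> u > 0"
proof -
  have "H10_norm \<Omega> u \<ge> 0"
    by (simp add: H10_norm_def)
  then show ?thesis
    using assms H10_AE_eq_0[of \<Omega> u] by (fastforce simp: H10_nonzero_def)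
qed

lemma L_norm_nonneg: "L_norm \<Omega> \<gamma> u \<ge> 0"
  by (simp add: L_norm_def)

text \<open>This includes the case where \<open>\<bar>u x\<bar> powr \<gamma>\<close> is not
  integrable: the integral then has the default value 0 on both sides.\<close>

lemma L_norm_scale:
  assumes "t > 0" "\<gamma> > 0"
  shows "L_norm \<Omega> \<gamma> (\<lambda>x. t * u x) = t * L_norm \<Omega> \<gamma> u"
  using assms by (simp add: L_norm_def abs_mult powr_mult powr_powr)

subsection \<open>The fibering maps\<close>

text \<open>If \<open>u\<close> has gradient norm \<open>r\<close> and \<open>\<beta> = norm_quotient \<Omega> \<gamma> u\<close>, the first derivative of its
  fibering map at \<open>1\<close> is \<open>r\<^sup>2 * fib a \<gamma> l \<beta> r\<close>. On the Nehari set the second derivative at \<open>1\<close>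
  has the sign of \<open>r - crit a \<gamma> l\<close>, where the critical radius does not depend on \<open>u\<close>.\<close>

definition fib :: "real \<Rightarrow> real \<Rightarrow> real \<Rightarrow> real \<Rightarrow> real \<Rightarrow> real" where
  "fib a \<gamma> l \<beta> r = a + l * r\<^sup>2 - \<beta> * r powr (\<gamma> - 2)"

definition crit :: "real \<Rightarrow> real \<Rightarrow> real \<Rightarrow> real" where
  "crit a \<gamma> l = sqrt (a * (\<gamma> - 2) / ((4 - \<gamma>) * l))"

locale fibering =
  fixes a \<gamma> l :: real
  assumes a: "a > 0" and \<gamma>: "2 < \<gamma>" "\<gamma> < 4" and l: "l > 0"
begin

abbreviation "\<tau> \<equiv> crit a \<gamma> l"

lemma crit_pos: "\<tau> > 0" and crit_sq: "l * \<tau>\<^sup>2 = a * (\<gamma> - 2) / (4 - \<gamma>)"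
  using a \<gamma> l by (auto simp: crit_def field_simps)

text \<open>At the critical radius the sum \<open>a + l * \<tau>\<^sup>2\<close> is free of
  \<open>l\<close>, so \<open>l\<close> enters only through the power of
  \<open>\<tau>\<close>.\<close>

lemma fib_crit: "fib a \<gamma> l \<beta> \<tau> = 2 * a / (4 - \<gamma>) - \<beta> * \<tau> powr (\<gamma> - 2)"
  using \<gamma> by (simp add: fib_def crit_sq field_simps)

text \<open>The exponent turns \<open>\<tau> powr (\<gamma> - 2)\<close> into
  \<open>\<tau>\<^sup>2\<close>, a constant divided by \<open>l\<close>. This explains the shape of
  \<open>C_const\<close>: its last factor cancels the same power of
  \<open>2 * a / (4 - \<gamma>)\<close>.\<close>

lemma crit_powr:
  assumes "\<beta> \<ge> 0"
  shows "(\<beta> * \<tau> powr (\<gamma> - 2)) powr (2 / (\<gamma> - 2))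
    = C_const a \<gamma> * \<beta> powr (2 / (\<gamma> - 2)) * (2 * a / (4 - \<gamma>)) powr (2 / (\<gamma> - 2)) / l"
proof -
  let ?e = "2 / (\<gamma> - 2)"
  have "(\<tau> powr (\<gamma> - 2)) powr ?e = \<tau>\<^sup>2"
  proof -
    have cancel: "k * (2 / k) = 2" if "k \<noteq> 0" for k :: real
      using that by simp
    have "(\<gamma> - 2) * ?e = 2"
      by (rule cancel) (use \<gamma> in simp)
    then have "(\<tau> powr (\<gamma> - 2)) powr ?e = \<tau> powr 2"
      by (simp only: powr_powr)
    then show ?thesis
      using crit_pos by simp
  qed
  also have "\<dots> = l * \<tau>\<^sup>2 / l"
    using l by simp
  also have "\<dots> = a * ((\<gamma> - 2) / (4 - \<gamma>)) / l"
    unfolding crit_sq by simp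
  finally have 1: "(\<tau> powr (\<gamma> - 2)) powr ?e = a * ((\<gamma> - 2) / (4 - \<gamma>)) / l" .
  have "((4 - \<gamma>) / (2 * a)) powr ?e * (2 * a / (4 - \<gamma>)) powr ?e = 1"
    using a \<gamma> by (simp flip: powr_mult)
  then have 2: "C_const a \<gamma> * (2 * a / (4 - \<gamma>)) powr ?e = a * ((\<gamma> - 2) / (4 - \<gamma>))"
    by (simp add: C_const_def)
  have "(\<beta> * \<tau> powr (\<gamma> - 2)) powr ?e = \<beta> powr ?e * (\<tau> powr (\<gamma> - 2)) powr ?e"
    using assms by (simp add: powr_mult)
  also have "\<dots> = \<beta> powr ?e * (C_const a \<gamma> * (2 * a / (4 - \<gamma>)) powr ?e / l)"
    unfolding 1 2 ..
  finally show ?thesis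
    by (simp only: ac_simps times_divide_eq_right)
qed

text \<open>Raising the two terms of \<open>fib\<close> at \<open>\<tau>\<close> to the positive
  power \<open>2 / (\<gamma> - 2)\<close> preserves their order; then the common factor
  cancels.\<close>

lemma
  assumes "\<beta> \<ge> 0"
  shows fib_crit_pos_iff: "0 < fib a \<gamma> l \<beta> \<tau> \<longleftrightarrow> C_const a \<gamma> * \<beta> powr (2 / (\<gamma> - 2)) < l"
    and fib_crit_neg_iff: "fib a \<gamma> l \<beta> \<tau> < 0 \<longleftrightarrow> l < C_const a \<gamma> * \<beta> powr (2 / (\<gamma> - 2))"
proof -
  let ?e = "2 / (\<gamma> - 2)" and ?X = "\<beta> * \<tau> powr (\<gamma> - 2)" and ?c = "2 * a / (4 - \<gamma>)"
  have e: "?e > 0" and X: "?X \<ge> 0" and c: "?c > 0"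
    using assms a \<gamma> by auto
  then have D: "?c powr ?e > 0"
    by (metis less_irrefl powr_gt_zero)
  have cmp: "x < y \<longleftrightarrow> x powr ?e < y powr ?e" if "x \<ge> 0" "y \<ge> 0" for x y
    using that e powr_less_mono2[of ?e x y] powr_mono2[of ?e y x] by (meson less_imp_le not_le)
  have "0 < fib a \<gamma> l \<beta> \<tau> \<longleftrightarrow> ?X powr ?e < ?c powr ?e"
    using cmp[OF X, of ?c] c by (simp add: fib_crit)
  also have "\<dots> \<longleftrightarrow> C_const a \<gamma> * \<beta> powr ?e < l"
    unfolding crit_powr[OF assms] using D l by (simp add: divide_less_eq mult.commute)
  finally show "0 < fib a \<gamma> l \<beta> \<tau> \<longleftrightarrow> C_const a \<gamma> * \<beta> powr ?e < l" .
  have "fib a \<gamma> l \<beta> \<tau> < 0 \<longleftrightarrow> ?c powr ?e < ?X powr ?e"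
    using cmp[OF _ X, of ?c] c by (simp add: fib_crit)
  also have "\<dots> \<longleftrightarrow> l < C_const a \<gamma> * \<beta> powr ?e"
    unfolding crit_powr[OF assms] using D l by (simp add: less_divide_eq mult.commute)
  finally show "fib a \<gamma> l \<beta> \<tau> < 0 \<longleftrightarrow> l < C_const a \<gamma> * \<beta> powr ?e" .
qed

text \<open>\<open>r powr (\<gamma> - 2)\<close> is a concave function of \<open>r\<^sup>2\<close>, hence lies below its tangent at \<open>\<tau>\<^sup>2\<close>, which
  turns the bound at \<open>\<tau>\<close> into one at every \<open>r\<close>.\<close>

lemma fib_lower_bound:
  assumes "\<beta> \<ge> 0" "r > 0"
  shows "fib a \<gamma> l \<beta> r \<ge> fib a \<gamma> l \<beta> \<tau> * ((4 - \<gamma>) / 2 + (\<gamma> - 2) / 2 * (r / \<tau>)\<^sup>2)"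
proof -
  define p where "p = (\<gamma> - 2) / 2"
  define y where "y = (r / \<tau>)\<^sup>2"
  have y: "y > 0" and p: "0 < p" "p < 1"
    using assms crit_pos \<gamma> by (auto simp: y_def p_def)
  have "(r / \<tau>) powr (\<gamma> - 2) = y powr p"
  proof -
    have "2 * p = \<gamma> - 2"
      by (simp add: p_def)
    moreover have "y = (r / \<tau>) powr 2"
      using assms crit_pos by (simp add: y_def)
    ultimately show ?thesis
      by (simp add: powr_powr)
  qed
  \<comment> \<open>Young's inequality for \<open>y\<close> and 1 with weights \<open>p\<close> and
    \<open>1 - p\<close>: the tangent at 1 of the concave power.\<close>
  also have "\<dots> \<le> 1 - p + p * y"
    using Youngs_inequality_0[of p "1 - p" y 1] p y by simp
  finally have "\<tau> powr (\<gamma> - 2) * (r / \<tau>) powr (\<gamma> - 2) \<le> \<tau> powr (\<gamma> - 2) * (1 - p + p * y)"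
    by (rule mult_left_mono) simp
  moreover have "\<tau> powr (\<gamma> - 2) * (r / \<tau>) powr (\<gamma> - 2) = r powr (\<gamma> - 2)"
    using crit_pos assms by (simp flip: powr_mult)
  ultimately have "\<beta> * r powr (\<gamma> - 2) \<le> \<beta> * (\<tau> powr (\<gamma> - 2) * (1 - p + p * y))"
    using assms by (simp add: mult_left_mono)
  \<comment> \<open>By the choice of \<open>\<tau>\<close>, the ratio of
    \<open>l * \<tau>\<^sup>2\<close> to \<open>a\<close> is that of \<open>p\<close> to
    \<open>1 - p\<close>, so this side is exactly proportional to the tangent.\<close>
  moreover have "a + l * r\<^sup>2 = 2 * a / (4 - \<gamma>) * (1 - p + p * y)"
  proof -
    have "r\<^sup>2 = y * \<tau>\<^sup>2"
      using crit_pos by (simp add: y_def power_divide)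
    then have "l * r\<^sup>2 = y * (l * \<tau>\<^sup>2)"
      by (simp add: mult.left_commute)
    then have "l * r\<^sup>2 = y * (a * (\<gamma> - 2) / (4 - \<gamma>))"
      unfolding crit_sq .
    then show ?thesis
      using \<gamma> by (simp add: p_def field_simps)
  qed
  ultimately have "fib a \<gamma> l \<beta> r \<ge> fib a \<gamma> l \<beta> \<tau> * (1 - p + p * y)"
    unfolding fib_crit by (simp add: fib_def left_diff_distrib)
  moreover have "1 - p = (4 - \<gamma>) / 2"
    by (simp add: p_def field_simps)
  ultimately have "fib a \<gamma> l \<beta> r \<ge> fib a \<gamma> l \<beta> \<tau> * ((4 - \<gamma>) / 2 + p * y)"
    by simp
  then show ?thesis
    unfolding p_def y_def .
qed

lemma fib_pos:
  assumes "\<beta> \<ge> 0" "r > 0" "C_const a \<gamma> * \<beta> powr (2 / (\<gamma> - 2)) < l"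
  shows "fib a \<gamma> l \<beta> r > 0"
proof -
  have "(4 - \<gamma>) / 2 + (\<gamma> - 2) / 2 * (r / \<tau>)\<^sup>2 > 0"
    using \<gamma> by (intro add_pos_nonneg) auto
  then have "fib a \<gamma> l \<beta> \<tau> * ((4 - \<gamma>) / 2 + (\<gamma> - 2) / 2 * (r / \<tau>)\<^sup>2) > 0"
    using assms fib_crit_pos_iff[of \<beta>] by (intro mult_pos_pos) auto
  then show ?thesis
    using fib_lower_bound[OF assms(1,2)] by linarith
qed

lemma fib_nonneg:
  assumes "\<beta> \<ge> 0" "r > 0" "C_const a \<gamma> * \<beta> powr (2 / (\<gamma> - 2)) \<le> l"
  shows "fib a \<gamma> l \<beta> r \<ge> 0"
proof -
  have "(4 - \<gamma>) / 2 + (\<gamma> - 2) / 2 * (r / \<tau>)\<^sup>2 \<ge> 0"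
    using \<gamma> by (intro add_nonneg_nonneg) auto
  then have "fib a \<gamma> l \<beta> \<tau> * ((4 - \<gamma>) / 2 + (\<gamma> - 2) / 2 * (r / \<tau>)\<^sup>2) \<ge> 0"
    using assms fib_crit_neg_iff[of \<beta>] by (intro mult_nonneg_nonneg) auto
  then show ?thesis
    using fib_lower_bound[OF assms(1,2)] by linarith
qed

text \<open>The function is negative at \<open>\<tau>\<close>, tends to \<open>a > 0\<close> at 0,
  and is eventually positive because \<open>\<gamma> - 2 < 2\<close> lets the quadratic term
  dominate. The intermediate value theorem applies on either side.\<close>

lemma fib_roots:
  assumes "\<beta> \<ge> 0" "l < C_const a \<gamma> * \<beta> powr (2 / (\<gamma> - 2))"
  obtains r1 r2 where "0 < r1" "r1 < \<tau>" "\<tau> < r2" "fib a \<gamma> l \<beta> r1 = 0" "fib a \<gamma> l \<beta> r2 = 0"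
proof -
  let ?f = "fib a \<gamma> l \<beta>"
  have neg: "?f \<tau> < 0"
    using assms fib_crit_neg_iff by blast
  \<comment> \<open>For \<open>\<beta> = 0\<close> the threshold is 0, as a power of 0 is 0, against
    \<open>l > 0\<close>.\<close>
  have "\<beta> \<noteq> 0"
    using assms l by auto
  then have \<beta>: "\<beta> > 0"
    using assms by simp
  have cont: "continuous_on {0<..} ?f"
    unfolding fib_def by (intro continuous_intros) auto
  define k where "k = \<gamma> - 2"
  have k: "0 < k" "k < 2"
    using \<gamma> by (auto simp: k_def)
  have "((\<lambda>r. a + l * r\<^sup>2 - \<beta> * r powr k) \<longlongrightarrow> a) (at_right 0)"
    using k \<beta> l by real_asymp
  then have "eventually (\<lambda>r. 0 < ?f r) (at_right 0)"
    unfolding fib_def k_def[symmetric] using a by (auto simp: order_tendsto_iff)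
  moreover have "eventually (\<lambda>r. 0 < r \<and> r < \<tau>) (at_right 0)"
    using crit_pos eventually_at_right[of 0 \<tau>] by auto
  ultimately have "eventually (\<lambda>r. 0 < ?f r \<and> 0 < r \<and> r < \<tau>) (at_right 0)"
    by eventually_elim auto
  then obtain s where s: "0 < ?f s" "0 < s" "s < \<tau>"
    using eventually_happens'[OF trivial_limit_at_right_real] by blast
  then obtain r1 where r1: "s \<le> r1" "r1 \<le> \<tau>" "?f r1 = 0"
    using IVT2'[of ?f \<tau> 0 s] neg continuous_on_subset[OF cont, of "{s..\<tau>}"] by (auto simp: subset_iff)
  have "eventually (\<lambda>r. 0 < a + l * r\<^sup>2 - \<beta> * r powr k) at_top"
    using k \<beta> l by real_asymp
  then have "eventually (\<lambda>r. 0 < ?f r) at_top"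
    unfolding fib_def k_def .
  then obtain s' where s': "0 < ?f s'" "\<tau> < s'"
    using eventually_gt_at_top[of \<tau>] eventually_happens'[OF trivial_limit_at_top_linorder]
    by (metis (mono_tags, lifting) eventually_conj)
  then obtain r2 where r2: "\<tau> \<le> r2" "?f r2 = 0"
    using IVT'[of ?f \<tau> 0 s'] neg crit_pos continuous_on_subset[OF cont, of "{\<tau>..s'}"]
    by (auto simp: subset_iff)
  show ?thesis
    using that[of r1 r2] r1 r2 s neg by (metis less_irrefl less_le order_less_le_trans)
qed

end

text \<open>The scaling laws give the formula for positive \<open>t\<close>, a neighbourhood of 1.
  The first derivative is computed at all such \<open>t\<close>, so that it can be differentiated
  again.\<close>

lemma deriv_fibering:
  fixes a l A B \<gamma> :: real and f :: "real \<Rightarrow> real"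
  assumes \<gamma>: "\<gamma> \<noteq> 0"
    and f: "\<And>t. t > 0 \<Longrightarrow> f t = a / 2 * A\<^sup>2 * t\<^sup>2 + l / 4 * A ^ 4 * t ^ 4 - 1 / \<gamma> * B * t powr \<gamma>"
  shows "deriv f 1 = a * A\<^sup>2 + l * A ^ 4 - B"
    and "deriv (deriv f) 1 = a * A\<^sup>2 + 3 * l * A ^ 4 - (\<gamma> - 1) * B"
proof -
  have 1: "(f has_field_derivative a * A\<^sup>2 * t + l * A ^ 4 * t ^ 3 - B * t powr (\<gamma> - 1)) (at t)"
    if "t > 0" for t
  proof (rule has_field_derivative_transform_within_open[OF _ open_greaterThan[of 0]])
    show "((\<lambda>t. a / 2 * A\<^sup>2 * t\<^sup>2 + l / 4 * A ^ 4 * t ^ 4 - 1 / \<gamma> * B * t powr \<gamma>) has_field_derivative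
        a * A\<^sup>2 * t + l * A ^ 4 * t ^ 3 - B * t powr (\<gamma> - 1)) (at t)"
      using that \<gamma> by (auto intro!: derivative_eq_intros simp: field_simps)
  qed (use that f in auto)
  then have 2: "deriv f t = a * A\<^sup>2 * t + l * A ^ 4 * t ^ 3 - B * t powr (\<gamma> - 1)" if "t > 0" for t
    using that DERIV_imp_deriv by blast
  from 2[of 1] show "deriv f 1 = a * A\<^sup>2 + l * A ^ 4 - B"
    by simp
  have "(deriv f has_field_derivative a * A\<^sup>2 + 3 * l * A ^ 4 - (\<gamma> - 1) * B) (at 1)"
  proof (rule has_field_derivative_transform_within_open[OF _ open_greaterThan[of 0]])
    show "((\<lambda>t. a * A\<^sup>2 * t + l * A ^ 4 * t ^ 3 - B * t powr (\<gamma> - 1)) has_field_derivative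
        a * A\<^sup>2 + 3 * l * A ^ 4 - (\<gamma> - 1) * B) (at 1)"
      by (auto intro!: derivative_eq_intros)
  qed (use 2 in auto)
  then show "deriv (deriv f) 1 = a * A\<^sup>2 + 3 * l * A ^ 4 - (\<gamma> - 1) * B"
    by (rule DERIV_imp_deriv)
qed

text \<open>This is the \<open>\<beta>\<close> of \<open>fib\<close>; with the power
  \<open>\<gamma>\<close> it enters the energy linearly.\<close>

definition norm_quotient :: "'a::euclidean_space set \<Rightarrow> real \<Rightarrow> ('a \<Rightarrow> real) \<Rightarrow> real" where
  "norm_quotient \<Omega> \<gamma> u = (L_norm \<Omega> \<gamma> u / H10_norm \<Omega> u) powr \<gamma>"

lemma norm_quotient_nonneg: "norm_quotient \<Omega> \<gamma> u \<ge> 0"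
  by (simp add: norm_quotient_def)

text \<open>Identifies \<open>lam\<close> with the threshold for the sign of \<open>fib\<close> at
  the critical radius.\<close>

lemma lam_eq: "lam \<Omega> a \<gamma> u = C_const a \<gamma> * norm_quotient \<Omega> \<gamma> u powr (2 / (\<gamma> - 2))"
  by (simp add: lam_def norm_quotient_def powr_powr mult.commute)

text \<open>The factor 2 belongs to \<open>l / 2\<close> and the power of
  \<open>2 / \<gamma>\<close> is absorbed into the quotient, so \<open>lam0\<close> is the threshold
  for the rescaled parameters of the energy.\<close>

lemma lam0_eq:
  assumes "\<gamma> > 0"
  shows "lam0 \<Omega> a \<gamma> u = 2 * (C_const a \<gamma> * (2 / \<gamma> * norm_quotient \<Omega> \<gamma> u) powr (2 / (\<gamma> - 2)))"
  using assms norm_quotient_nonneg[of \<Omega> \<gamma> u]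
  by (simp only: lam0_def lam_eq powr_mult) (simp add: powr_mult)

section \<open>Nehari sets and energy of Sobolev functions\<close>

context fibering
begin

context
  fixes \<Omega> :: "'a::euclidean_space set"
  assumes \<Omega>: "open \<Omega>" "bounded \<Omega>"
begin

text \<open>Written this way, the square of the gradient norm factors out of the energy and of its
  derivative along rays.\<close>

lemma L_norm_powr:
  assumes "u \<in> H10_nonzero \<Omega>"
  shows "L_norm \<Omega> \<gamma> u powr \<gamma>
    = (H10_norm \<Omega> u)\<^sup>2 * (norm_quotient \<Omega> \<gamma> u * H10_norm \<Omega> u powr (\<gamma> - 2))"
proof -
  let ?A = "H10_norm \<Omega> u"
  have A: "?A > 0"
    by (rule H10_norm_pos[OF \<Omega> assms])
  have "?A\<^sup>2 * ?A powr (\<gamma> - 2) = ?A powr \<gamma>"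
    using A by (simp add: powr_diff)
  moreover have "norm_quotient \<Omega> \<gamma> u * ?A powr \<gamma> = L_norm \<Omega> \<gamma> u powr \<gamma>"
    using A L_norm_nonneg[of \<Omega> \<gamma> u] by (simp add: norm_quotient_def powr_divide)
  ultimately show ?thesis
    by (simp add: mult.left_commute)
qed

lemma norms_scale:
  assumes u: "u \<in> H10_nonzero \<Omega>" and t: "t > 0"
  shows "H10_norm \<Omega> (\<lambda>x. t * u x) = t * H10_norm \<Omega> u"
    and "norm_quotient \<Omega> \<gamma> (\<lambda>x. t * u x) = norm_quotient \<Omega> \<gamma> u"
proof -
  have "u \<in> H1 \<Omega>"
    using u by (simp add: H10_nonzero_def H10_def)
  then show *: "H10_norm \<Omega> (\<lambda>x. t * u x) = t * H10_norm \<Omega> u"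
    using H1_scale(2)[OF \<Omega>(1), of u t] t by simp
  show "norm_quotient \<Omega> \<gamma> (\<lambda>x. t * u x) = norm_quotient \<Omega> \<gamma> u"
    using t \<gamma> by (simp add: norm_quotient_def * L_norm_scale)
qed

text \<open>The ray through \<open>u\<close> meets every radius without changing the quotient, so a
  root of \<open>fib\<close> is realised by a function.\<close>

lemma obtain_scaled:
  assumes u: "u \<in> H10_nonzero \<Omega>" and r: "r > 0"
  obtains v where "v \<in> H10_nonzero \<Omega>" "H10_norm \<Omega> v = r" "norm_quotient \<Omega> \<gamma> v = norm_quotient \<Omega> \<gamma> u"
proof -
  define t where "t = r / H10_norm \<Omega> u"
  have "H10_norm \<Omega> u > 0"
    by (rule H10_norm_pos[OF \<Omega> u])
  then have "t > 0" "t * H10_norm \<Omega> u = r"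
    using r by (auto simp: t_def)
  then show ?thesis
    using that[OF H10_nonzero_scale[OF \<Omega>(1) u, of t]] norms_scale[OF u, of t] by simp
qed

lemma psi_eq:
  assumes u: "u \<in> H10_nonzero \<Omega>" and t: "t > 0"
  shows "psi \<Omega> a \<gamma> l u t = a / 2 * (H10_norm \<Omega> u)\<^sup>2 * t\<^sup>2 + l / 4 * H10_norm \<Omega> u ^ 4 * t ^ 4
    - 1 / \<gamma> * L_norm \<Omega> \<gamma> u powr \<gamma> * t powr \<gamma>"
  using norms_scale(1)[OF u t] L_norm_scale[OF t, of \<gamma> \<Omega> u] t \<gamma> L_norm_nonneg[of \<Omega> \<gamma> u]
  by (simp add: psi_def Phi_def power_mult_distrib powr_mult ac_simps)

lemma Nehari_iff:
  assumes u: "u \<in> H10_nonzero \<Omega>"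
  shows "u \<in> Nehari \<Omega> a \<gamma> l \<longleftrightarrow> fib a \<gamma> l (norm_quotient \<Omega> \<gamma> u) (H10_norm \<Omega> u) = 0"
proof -
  have "deriv (psi \<Omega> a \<gamma> l u) 1 = a * (H10_norm \<Omega> u)\<^sup>2 + l * H10_norm \<Omega> u ^ 4 - L_norm \<Omega> \<gamma> u powr \<gamma>"
    by (rule deriv_fibering(1)[where \<gamma> = \<gamma>]) (use \<gamma> in simp, rule psi_eq[OF u])
  also have "\<dots> = (H10_norm \<Omega> u)\<^sup>2 * fib a \<gamma> l (norm_quotient \<Omega> \<gamma> u) (H10_norm \<Omega> u)"
    unfolding L_norm_powr[OF u] fib_def by (simp add: algebra_simps power2_eq_square power4_eq_xxxx)
  finally show ?thesis
    using u H10_norm_pos[OF \<Omega> u] by (simp add: Nehari_def)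
qed

text \<open>The Nehari equation eliminates the \<open>L_norm\<close> term, leaving a polynomial in
  the gradient norm alone.\<close>

lemma Nehari_deriv2:
  assumes u: "u \<in> Nehari \<Omega> a \<gamma> l"
  shows "deriv (deriv (psi \<Omega> a \<gamma> l u)) 1
    = (4 - \<gamma>) * l * (H10_norm \<Omega> u)\<^sup>2 * ((H10_norm \<Omega> u)\<^sup>2 - \<tau>\<^sup>2)"
proof -
  let ?A = "H10_norm \<Omega> u" and ?B = "L_norm \<Omega> \<gamma> u powr \<gamma>"
  have u0: "u \<in> H10_nonzero \<Omega>" and 0: "deriv (psi \<Omega> a \<gamma> l u) 1 = 0"
    using u by (auto simp: Nehari_def)
  have "deriv (psi \<Omega> a \<gamma> l u) 1 = a * ?A\<^sup>2 + l * ?A ^ 4 - ?B"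
    by (rule deriv_fibering(1)[where \<gamma> = \<gamma>]) (use \<gamma> in simp, rule psi_eq[OF u0])
  with 0 have B: "?B = a * ?A\<^sup>2 + l * ?A ^ 4"
    by simp
  have "deriv (deriv (psi \<Omega> a \<gamma> l u)) 1 = a * ?A\<^sup>2 + 3 * l * ?A ^ 4 - (\<gamma> - 1) * ?B"
    by (rule deriv_fibering(2)[where \<gamma> = \<gamma>]) (use \<gamma> in simp, rule psi_eq[OF u0])
  also have "\<dots> = ?A\<^sup>2 * ((4 - \<gamma>) * (l * ?A\<^sup>2) - a * (\<gamma> - 2))"
    unfolding B by (simp add: algebra_simps power2_eq_square power4_eq_xxxx)
  also have "a * (\<gamma> - 2) = (4 - \<gamma>) * (l * \<tau>\<^sup>2)"
    using \<gamma> by (simp add: crit_sq)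
  finally show ?thesis
    by (simp add: algebra_simps)
qed

text \<open>Some \<open>u\<close> has \<open>lam\<close> above \<open>l\<close>; scaled to the root
  below \<open>\<tau>\<close> it lies in \<open>Nehari_minus\<close>, and to the root above in
  \<open>Nehari_plus\<close>.\<close>

lemma Nehari_plus_minus_nonempty:
  assumes "ereal l < lam_star \<Omega> a \<gamma>"
  shows "Nehari_plus \<Omega> a \<gamma> l \<noteq> {} \<and> Nehari_minus \<Omega> a \<gamma> l \<noteq> {}"
proof -
  obtain u where u: "u \<in> H10_nonzero \<Omega>" "l < lam \<Omega> a \<gamma> u"
    using assms by (auto simp: lam_star_def less_SUP_iff)
  then obtain r1 r2 where r: "0 < r1" "r1 < \<tau>" "\<tau> < r2"
    "fib a \<gamma> l (norm_quotient \<Omega> \<gamma> u) r1 = 0" "fib a \<gamma> l (norm_quotient \<Omega> \<gamma> u) r2 = 0"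
    using fib_roots[OF norm_quotient_nonneg[of \<Omega> \<gamma> u]] unfolding lam_eq by blast
  have r2: "r2 > 0"
    using r crit_pos by linarith
  obtain v where v: "v \<in> Nehari \<Omega> a \<gamma> l" "H10_norm \<Omega> v = r1"
    using obtain_scaled[OF u(1) r(1)] Nehari_iff r(4) by metis
  have "(4 - \<gamma>) * l * r1\<^sup>2 > 0" "r1\<^sup>2 < \<tau>\<^sup>2"
    using \<gamma> l r by (auto intro: power_strict_mono)
  then have "v \<in> Nehari_minus \<Omega> a \<gamma> l"
    using v Nehari_deriv2[OF v(1)] by (simp add: Nehari_minus_def mult_pos_neg)
  moreover obtain w where w: "w \<in> Nehari \<Omega> a \<gamma> l" "H10_norm \<Omega> w = r2"
    using obtain_scaled[OF u(1) r2] Nehari_iff r(5) by metis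
  have "(4 - \<gamma>) * l * r2\<^sup>2 > 0" "\<tau>\<^sup>2 < r2\<^sup>2"
    using \<gamma> l r r2 crit_pos by (auto intro: power_strict_mono)
  then have "w \<in> Nehari_plus \<Omega> a \<gamma> l"
    using w Nehari_deriv2[OF w(1)] by (simp add: Nehari_plus_def)
  ultimately show ?thesis by blast
qed

lemma Nehari_empty:
  assumes "ereal l > lam_star \<Omega> a \<gamma>"
  shows "Nehari \<Omega> a \<gamma> l = {}"
proof -
  have "u \<notin> Nehari \<Omega> a \<gamma> l" if u: "u \<in> H10_nonzero \<Omega>" for u
  proof -
    have "ereal (lam \<Omega> a \<gamma> u) \<le> lam_star \<Omega> a \<gamma>"
      unfolding lam_star_def using u by (rule SUP_upper)
    then have "ereal (lam \<Omega> a \<gamma> u) < ereal l"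
      using assms by (rule le_less_trans)
    then have "lam \<Omega> a \<gamma> u < l"
      by simp
    then have "fib a \<gamma> l (norm_quotient \<Omega> \<gamma> u) (H10_norm \<Omega> u) > 0"
      unfolding lam_eq by (rule fib_pos[OF norm_quotient_nonneg H10_norm_pos[OF \<Omega> u]])
    then show ?thesis
      using Nehari_iff[OF u] by simp
  qed
  then show ?thesis
    by (auto simp: Nehari_def)
qed

text \<open>The energy has the same shape as the derivative; pulling out half the squared gradient
  norm turns \<open>l / 4\<close> into \<open>l / 2\<close> and \<open>1 / \<gamma>\<close> into
  \<open>2 / \<gamma>\<close>.\<close>

lemma Phi_eq:
  assumes u: "u \<in> H10_nonzero \<Omega>"
  shows "Phi \<Omega> a \<gamma> l u = (H10_norm \<Omega> u)\<^sup>2 / 2 *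
    fib a \<gamma> (l / 2) (2 / \<gamma> * norm_quotient \<Omega> \<gamma> u) (H10_norm \<Omega> u)"
  unfolding Phi_def L_norm_powr[OF u] fib_def
  by (simp add: algebra_simps power2_eq_square power4_eq_xxxx)

lemma fibering_half: "fibering a \<gamma> (l / 2)"
  using a \<gamma> l by unfold_locales auto

text \<open>The witness is a multiple of \<open>u\<close> placed at the critical radius for
  \<open>l / 2\<close>, where the sign test is exact.\<close>

lemma Phi_negative:
  assumes "ereal l < lam0_star \<Omega> a \<gamma>"
  shows "\<exists>u\<in>H10_nonzero \<Omega>. Phi \<Omega> a \<gamma> l u < 0"
proof -
  obtain u where u: "u \<in> H10_nonzero \<Omega>" "l < lam0 \<Omega> a \<gamma> u"
    using assms by (auto simp: lam0_star_def less_SUP_iff)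
  let ?\<beta> = "2 / \<gamma> * norm_quotient \<Omega> \<gamma> u" and ?r = "crit a \<gamma> (l / 2)"
  have \<beta>: "?\<beta> \<ge> 0"
    using \<gamma> by (intro mult_nonneg_nonneg norm_quotient_nonneg) simp
  have "l / 2 < C_const a \<gamma> * ?\<beta> powr (2 / (\<gamma> - 2))"
    using u(2) \<gamma> by (simp add: lam0_eq)
  then have "fib a \<gamma> (l / 2) ?\<beta> ?r < 0"
    using fibering.fib_crit_neg_iff[OF fibering_half \<beta>] by blast
  moreover have r: "?r > 0"
    by (rule fibering.crit_pos[OF fibering_half])
  moreover obtain v where v: "v \<in> H10_nonzero \<Omega>" "H10_norm \<Omega> v = ?r"
    "norm_quotient \<Omega> \<gamma> v = norm_quotient \<Omega> \<gamma> u"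
    using obtain_scaled[OF u(1) r] by blast
  ultimately have "Phi \<Omega> a \<gamma> l v < 0"
    unfolding Phi_eq[OF v(1)] v by (intro mult_pos_neg) auto
  then show ?thesis using v by blast
qed

text \<open>Nonnegativity of the rescaled \<open>fib\<close> at every radius bounds the infimum
  below; the behaviour as \<open>t\<close> tends to 0 bounds it above.\<close>

lemma psi_INF_eq_0:
  assumes lam0: "ereal l \<ge> lam0_star \<Omega> a \<gamma>" and u: "u \<in> H10_nonzero \<Omega>"
  shows "(INF t\<in>{0<..}. ereal (psi \<Omega> a \<gamma> l u t)) = 0"
proof (rule antisym)
  let ?q = "norm_quotient \<Omega> \<gamma> u" and ?A = "H10_norm \<Omega> u"
  let ?\<beta> = "2 / \<gamma> * ?q"
  have \<beta>: "?\<beta> \<ge> 0"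
    using \<gamma> by (intro mult_nonneg_nonneg norm_quotient_nonneg) simp
  have "ereal (lam0 \<Omega> a \<gamma> u) \<le> lam0_star \<Omega> a \<gamma>"
    unfolding lam0_star_def using u by (rule SUP_upper)
  then have "ereal (lam0 \<Omega> a \<gamma> u) \<le> ereal l"
    using lam0 by (rule order_trans)
  then have le: "C_const a \<gamma> * ?\<beta> powr (2 / (\<gamma> - 2)) \<le> l / 2"
    using \<gamma> by (simp add: lam0_eq)
  show "0 \<le> (INF t\<in>{0<..}. ereal (psi \<Omega> a \<gamma> l u t))"
  proof (rule INF_greatest)
    fix t :: real assume "t \<in> {0<..}"
    then have t: "t > 0" by simp
    let ?v = "\<lambda>x. t * u x"
    have v: "?v \<in> H10_nonzero \<Omega>"
      using H10_nonzero_scale[OF \<Omega>(1) u, of t] t by simp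
    have "fib a \<gamma> (l / 2) ?\<beta> (H10_norm \<Omega> ?v) \<ge> 0"
      by (rule fibering.fib_nonneg[OF fibering_half \<beta> H10_norm_pos[OF \<Omega> v] le])
    then have "Phi \<Omega> a \<gamma> l ?v \<ge> 0"
      unfolding Phi_eq[OF v] norms_scale(2)[OF u t] by simp
    then show "0 \<le> ereal (psi \<Omega> a \<gamma> l u t)"
      by (simp add: psi_def)
  qed
  \<comment> \<open>Dropping the nonpositive \<open>L_norm\<close> term leaves a polynomial upper
    bound that tends to 0 with \<open>t\<close>.\<close>
  let ?p = "\<lambda>t. a / 2 * ?A\<^sup>2 * t\<^sup>2 + l / 4 * ?A ^ 4 * t ^ 4"
  have "(?p \<longlongrightarrow> ?p 0) (at_right 0)"
    by (intro tendsto_intros)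
  then have lim: "((\<lambda>t. ereal (?p t)) \<longlongrightarrow> ereal 0) (at_right 0)"
    by (intro tendsto_ereal) simp
  have "(INF t\<in>{0<..}. ereal (psi \<Omega> a \<gamma> l u t)) \<le> ereal (?p t)" if t: "t > 0" for t
  proof (rule INF_lower2[of t])
    show "ereal (psi \<Omega> a \<gamma> l u t) \<le> ereal (?p t)"
      using \<gamma> by (simp add: psi_eq[OF u t])
  qed (use t in simp)
  then have "eventually (\<lambda>t. (INF t\<in>{0<..}. ereal (psi \<Omega> a \<gamma> l u t)) \<le> ereal (?p t)) (at_right 0)"
    by (auto simp: eventually_at_filter)
  from tendsto_lowerbound[OF lim this]
  show "(INF t\<in>{0<..}. ereal (psi \<Omega> a \<gamma> l u t)) \<le> 0"
    by (simp add: zero_ereal_def)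
qed

end

end

theorem proposition2p5:
  fixes \<Omega> :: "(real ^ 3) set" and a \<gamma> :: real
  assumes "bounded_regular_domain \<Omega>" and "a > 0" and "2 < \<gamma>" and "\<gamma> < 4"
  shows "(\<forall>l>0. (ereal l < lam_star \<Omega> a \<gamma> \<longrightarrow>
              Nehari_plus \<Omega> a \<gamma> l \<noteq> {} \<and> Nehari_minus \<Omega> a \<gamma> l \<noteq> {}) \<and>
            (ereal l > lam_star \<Omega> a \<gamma> \<longrightarrow> Nehari \<Omega> a \<gamma> l = {})) \<and>
         (\<forall>l>0. (ereal l < lam0_star \<Omega> a \<gamma> \<longrightarrow>
              (\<exists>u\<in>H10_nonzero \<Omega>. Phi \<Omega> a \<gamma> l u < 0)) \<and>
            (ereal l \<ge> lam0_star \<Omega> a \<gamma> \<longrightarrow>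
              (\<forall>u\<in>H10_nonzero \<Omega>. (INF t\<in>{0<..}. ereal (psi \<Omega> a \<gamma> l u t)) = 0)))"
proof -
  have \<Omega>: "open \<Omega>" "bounded \<Omega>"
    using assms(1) by (auto simp: bounded_regular_domain_def)
  have "fibering a \<gamma> l" if "l > 0" for l
    using that assms by unfold_locales
  then show ?thesis
    using fibering.Nehari_plus_minus_nonempty[OF _ \<Omega>] fibering.Nehari_empty[OF _ \<Omega>]
      fibering.Phi_negative[OF _ \<Omega>] fibering.psi_INF_eq_0[OF _ \<Omega>]
    by blast
qed

end
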